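(* Let $\epsilon > 0$. For $X > 0$ let $E(X)$ be the set of real $x \in [X, 2X]$ such that the interval $[x, x + x^{13/55 + \epsilon}]$ contains no integer of the form $n = n_1 n_2 n_3$ with positive integers $n_1, n_2, n_3$ satisfying $x^{1/3}/2 \le n_1, n_2, n_3 \le 2 x^{1/3}$. Then the Lebesgue measure of $E(X)$ is $o(X)$ as $X \to \infty$. *)

theory Defs
  imports "HOL-Analysis.Analysis" "HOL-Library.Landau_Symbols"
begin

definition balanced_triple_products :: "real \<Rightarrow> nat set" where
  "balanced_triple_products x =
     {n\<^sub>1 * n\<^sub>2 * n\<^sub>3 | n\<^sub>1 n\<^sub>2 n\<^sub>3 :: nat. 0 < n\<^sub>1 \<and> 0 < n\<^sub>2 \<and> 0 < n\<^sub>3 \<and>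
        real n\<^sub>1 \<in> {x powr (1/3) / 2 .. 2 * x powr (1/3)} \<and>
        real n\<^sub>2 \<in> {x powr (1/3) / 2 .. 2 * x powr (1/3)} \<and>
        real n\<^sub>3 \<in> {x powr (1/3) / 2 .. 2 * x powr (1/3)}}"

definition exceptional_set :: "real \<Rightarrow> real \<Rightarrow> real set" where
  "exceptional_set \<epsilon> X =
     {x \<in> {X..2 * X}. \<not> (\<exists>n \<in> balanced_triple_products x.
        real n \<in> {x .. x + x powr (13/55 + \<epsilon>)})}"

text \<open>Since \<^const>\<open>measure\<close> is \<open>0\<close> on non-measurable sets, the following rules out that
  a bound on the measure of the exceptional set holds for a spurious reason.\<close>

lemma exceptional_set_borel: "exceptional_set \<epsilon> X \<in> sets borel"
proof -
  have "exceptional_set \<epsilon> X =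
     {x \<in> space borel. X \<le> x \<and> x \<le> 2 * X \<and> \<not> (\<exists>a b c :: nat. 0 < a \<and> 0 < b \<and> 0 < c \<and>
        (x powr (1/3) / 2 \<le> real a \<and> real a \<le> 2 * x powr (1/3)) \<and>
        (x powr (1/3) / 2 \<le> real b \<and> real b \<le> 2 * x powr (1/3)) \<and>
        (x powr (1/3) / 2 \<le> real c \<and> real c \<le> 2 * x powr (1/3)) \<and>
        x \<le> real (a * b * c) \<and> real (a * b * c) \<le> x + x powr (13/55 + \<epsilon>))}"
    unfolding exceptional_set_def balanced_triple_products_def atLeastAtMost_iff space_borel
    by blast
  also have "\<dots> \<in> sets borel"
    by measurable
  finally show ?thesis .
qed

end

theory Submission
  imports Defs "HOL-Computational_Algebra.Primes" "HOL-Computational_Algebra.Polynomial"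
begin

text \<open>
  Only products of a special shape are needed. Take \<open>n\<^sub>1 = k l\<close> with \<open>k\<close> running over all integers in
  \<open>[K, 2K)\<close>, where \<open>K \<approx> X\<^bsup>13/55\<^esup>\<close>, and let \<open>m = l n\<^sub>2 n\<^sub>3\<close> lie in a narrow range around \<open>X / K\<close>. Put
  \<open>ln x\<close> on a circle of length \<open>ln 2\<close>, so that \<open>[X, 2X]\<close> is exactly one turn, and detect the points
  \<open>ln (k m)\<close> near \<open>ln x\<close> by a trigonometric polynomial concentrated near \<open>0\<close>. By Parseval the variance
  of the number of such points, weighted by \<open>1 / k\<close>, is governed by
  \<open>\<Sum>\<^sub>j |\<Sum>\<^sub>k k\<^bsup>-1+it\<^esup>|\<^sup>2 |\<Sum>\<^sub>m m\<^bsup>it\<^esup>|\<^sup>2\<close> over the frequencies \<open>t = 2\<pi>j / ln 2\<close> with \<open>0 < |j| \<le> X / K\<close>. The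
  sum over \<open>k\<close> saves a power of \<open>X\<close> uniformly (up to three van der Corput differencings followed by
  the Kusmin-Landau inequality), while for the sum over \<open>m\<close> the large sieve loses nothing because
  there are only \<open>X / K\<close> frequencies; the divisor bound shows that there are enough distinct \<open>m\<close>.
\<close>

section \<open>Exponential sums\<close>

text \<open>The weight \<open>1 / k\<close> and the circle length \<open>ln 2\<close> belong
  together. At low frequencies \<open>k^(it)\<close> oscillates too little for differencing to help,
  but \<open>dk / k\<close> is the uniform measure on the circle and \<open>[K, 2K)\<close> is
  exactly one turn, so the weighted sum nearly cancels anyway. High frequencies reach about
  \<open>X / K = X^(42/55)\<close>, which is roughly \<open>K^(42/13)\<close>; this ratio is why
  three differencings are provided for. The detecting polynomial needs no smooth cutoff: it is the
  \<open>2 r\<close>-th power of the modulus of a geometric sum of length about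
  \<open>X / (K r)\<close>. Up to constants, the permitted window exceeds the resolution
  \<open>K / X\<close> by the factor \<open>X^\<epsilon>\<close>, so once
  \<open>r \<epsilon> \<ge> 1\<close> the kernel off the window drops below half its mean. An
  exceptional \<open>x\<close> away from the end points therefore deviates from the mean by at least
  half of it, and the variance bounds the measure of such \<open>x\<close>. The divisor bound is
  applied with so small an exponent that its loss \<open>X^(1/2000)\<close> is beaten by the saving
  \<open>X^(-13/11000)\<close>.\<close>

lemma cot_le_inverse:
  fixes x :: real
  assumes "0 < x" "x \<le> pi / 2"
  shows "cot x \<le> 1 / x"
proof -
  have "sin 0 - 0 * cos 0 \<le> sin x - x * cos x"
  proof (rule DERIV_nonneg_imp_nondecreasing[where f = "\<lambda>y. sin y - y * cos y"])
    fix y assume y: "0 \<le> y" "y \<le> x"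
    have "((\<lambda>y. sin y - y * cos y) has_real_derivative y * sin y) (at y)"
      by (auto intro!: derivative_eq_intros)
    moreover have "0 \<le> y * sin y"
      using y assms by (intro mult_nonneg_nonneg sin_ge_zero) auto
    ultimately show "\<exists>z. ((\<lambda>y. sin y - y * cos y) has_real_derivative z) (at y) \<and> 0 \<le> z"
      by blast
  qed (use assms in auto)
  moreover have "0 < sin x"
    using assms by (intro sin_gt_zero) auto
  ultimately show ?thesis
    using assms by (simp add: cot_def field_simps)
qed

text \<open>The reciprocal of \<open>1 - cis \<delta>\<close> has constant real part 1/2. As
  \<open>\<delta>\<close> varies monotonically it moves in one direction along a vertical line, so
  its total variation telescopes.\<close>

lemma inverse_one_minus_cis:
  fixes \<delta> :: real
  assumes "sin (\<delta> / 2) \<noteq> 0"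
  shows "(1 - cis \<delta>) * Complex (1 / 2) (cot (\<delta> / 2) / 2) = 1"
proof -
  define h where "h = \<delta> / 2"
  have d: "\<delta> = 2 * h" by (simp add: h_def)
  have s: "sin h \<noteq> 0" using assms by (simp add: h_def)
  have q: "cos h * cos h + sin h * sin h = 1"
    using sin_cos_squared_add3[of h] by simp
  have c: "1 - cos (2 * h) = 2 * (sin h * sin h)"
    by (simp add: cos_double_sin power2_eq_square)
  have "(1 - cos (2 * h)) * (1 / 2) + sin (2 * h) * (cot h / 2) = 1"
    unfolding c sin_double cot_def using s q by (simp add: field_simps)
  moreover have "(1 - cos (2 * h)) * (cot h / 2) - sin (2 * h) * (1 / 2) = 0"
    unfolding c sin_double cot_def using s by (simp add: field_simps)
  ultimately show ?thesis
    unfolding d by (simp add: complex_eq_iff)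
qed

lemma cot_antimono:
  fixes x y :: real
  assumes "0 < x" "x \<le> y" "y \<le> pi / 2"
  shows "cot y \<le> cot x"
  unfolding cot_def
  using assms
  by (intro frac_le cos_ge_zero cos_monotone_0_pi_le sin_gt_zero sin_monotone_2pi_le) auto

text \<open>With \<open>c n\<close> the reciprocal of \<open>1 - cis (\<delta> n)\<close>, every
  term equals \<open>(z n - z (Suc n)) * c n\<close>, and summation by parts bounds the sum by the
  end values of \<open>c\<close> plus its variation. Increments of at most \<open>pi\<close> keep
  the cotangents nonnegative; decreasing increments make them increase, so the variation is just
  \<open>T m - T a\<close>.\<close>

theorem kusmin_landau:
  fixes g :: "nat \<Rightarrow> real"
  assumes \<theta>: "0 < \<theta>"
    and lower: "\<And>n. a \<le> n \<Longrightarrow> n < b \<Longrightarrow> \<theta> \<le> g (Suc n) - g n"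
    and upper: "\<And>n. a \<le> n \<Longrightarrow> n < b \<Longrightarrow> g (Suc n) - g n \<le> pi"
    and decr: "\<And>n. a \<le> n \<Longrightarrow> Suc n < b \<Longrightarrow> g (Suc (Suc n)) - g (Suc n) \<le> g (Suc n) - g n"
  shows "norm (\<Sum>n\<in>{a..<b}. cis (g n)) \<le> 6 / \<theta>"
proof (cases "a < b")
  case False
  then show ?thesis using \<theta> by simp
next
  case True
  define \<delta> where "\<delta> n = g (Suc n) - g n" for n
  define T where "T n = cot (\<delta> n / 2) / 2" for n
  define c where "c n = Complex (1 / 2) (T n)" for n
  define z where "z n = cis (g n)" for n
  have range: "0 < \<delta> n / 2" "\<delta> n / 2 \<le> pi / 2" if "a \<le> n" "n < b" for n
    using lower[OF that] upper[OF that] \<theta> by (auto simp: \<delta>_def)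
  have z_eq: "z n = (z n - z (Suc n)) * c n" if "a \<le> n" "n < b" for n
  proof -
    have "sin (\<delta> n / 2) \<noteq> 0"
      using range[OF that] pi_gt_zero by (intro less_imp_neq[symmetric] sin_gt_zero) auto
    from inverse_one_minus_cis[OF this] have "(1 - cis (\<delta> n)) * c n = 1"
      by (simp add: c_def T_def)
    moreover have "z (Suc n) = z n * cis (\<delta> n)"
      by (simp add: z_def \<delta>_def cis_mult)
    ultimately have "(z n - z (Suc n)) * c n = z n * ((1 - cis (\<delta> n)) * c n)"
      by (simp add: algebra_simps)
    with \<open>(1 - cis (\<delta> n)) * c n = 1\<close> show ?thesis by simp
  qed
  have T_nonneg: "0 \<le> T n" and T_le: "T n \<le> 1 / \<theta>" if "a \<le> n" "n < b" for n
  proof -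
    show "0 \<le> T n"
      using range[OF that] cot_antimono[of "\<delta> n / 2" "pi / 2"] by (simp add: T_def cot_def)
    have "cot (\<delta> n / 2) \<le> 1 / (\<delta> n / 2)"
      by (rule cot_le_inverse[OF range[OF that]])
    also have "\<dots> = 2 / \<delta> n" by simp
    also have "\<dots> \<le> 2 / \<theta>"
      using lower[OF that] \<theta> by (intro divide_left_mono) (auto simp: \<delta>_def)
    finally show "T n \<le> 1 / \<theta>" by (simp add: T_def)
  qed
  have T_mono: "T n \<le> T (Suc n)" if "a \<le> n" "Suc n < b" for n
    using cot_antimono[of "\<delta> (Suc n) / 2" "\<delta> n / 2"] range[of n] range[of "Suc n"] decr[OF that] that
    by (simp add: T_def \<delta>_def)
  have c_norm: "norm (c n) \<le> 1 / 2 + T n" if "a \<le> n" "n < b" for n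
    using cmod_le[of "c n"] T_nonneg[OF that] by (simp add: c_def)
  have z_norm: "norm (z n) = 1" for n by (simp add: z_def)
  \<comment> \<open>Carrying the boundary term \<open>z (Suc n) * c n\<close> along means that each
    induction step adds only \<open>c (Suc n) - c n\<close>, up to a unimodular factor.\<close>
  have partial: "norm ((\<Sum>k\<in>{a..<Suc n}. (z k - z (Suc k)) * c k) + z (Suc n) * c n)
      \<le> norm (c a) + (T n - T a)" if "a \<le> n" "n < b" for n
    using that
  proof (induction n rule: dec_induct)
    case base
    then show ?case by (simp add: algebra_simps norm_mult z_norm)
  next
    case (step n)
    have "(\<Sum>k\<in>{a..<Suc (Suc n)}. (z k - z (Suc k)) * c k) + z (Suc (Suc n)) * c (Suc n)
        = ((\<Sum>k\<in>{a..<Suc n}. (z k - z (Suc k)) * c k) + z (Suc n) * c n)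
          + z (Suc n) * (c (Suc n) - c n)"
      using step by (simp add: algebra_simps)
    also have "norm \<dots> \<le> (norm (c a) + (T n - T a)) + norm (c (Suc n) - c n)"
    proof (rule order.trans[OF norm_triangle_ineq add_mono])
      show "norm ((\<Sum>k\<in>{a..<Suc n}. (z k - z (Suc k)) * c k) + z (Suc n) * c n)
          \<le> norm (c a) + (T n - T a)"
        using step by auto
    qed (simp add: norm_mult z_norm)
    also have "norm (c (Suc n) - c n) = T (Suc n) - T n"
      using T_mono[of n] step by (simp add: c_def norm_complex_def)
    finally show ?case by simp
  qed
  define m where "m = b - 1"
  have m: "a \<le> m" "m < b" "b = Suc m" using True by (auto simp: m_def)
  have "(\<Sum>n\<in>{a..<b}. cis (g n)) = (\<Sum>k\<in>{a..<Suc m}. (z k - z (Suc k)) * c k)"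
    unfolding m(3) using z_eq m by (intro sum.cong) (auto simp: z_def)
  also have "\<dots> = ((\<Sum>k\<in>{a..<Suc m}. (z k - z (Suc k)) * c k) + z (Suc m) * c m) - z (Suc m) * c m"
    by simp
  also have "norm \<dots> \<le> (norm (c a) + (T m - T a)) + norm (c m)"
    by (rule order.trans[OF norm_triangle_ineq4 add_mono[OF partial[OF m(1,2)]]])
       (simp add: norm_mult z_norm)
  also have "\<dots> \<le> 1 + 2 * T m"
    using c_norm[of a] c_norm[of m] m True by auto
  also have "\<dots> \<le> 1 + 2 / \<theta>"
    using T_le[of m] m by simp
  \<comment> \<open>Any single increment shows \<open>\<theta> \<le> pi < 4\<close>, so the leftover
    1 is absorbed and the constant becomes \<open>4 + 2\<close>.\<close>
  also have "1 \<le> 4 / \<theta>"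
    using lower[of a] upper[of a] True \<theta> pi_less_4 by (auto simp: field_simps)
  finally show ?thesis by simp
qed

text \<open>\<open>Q\<close> times the sum is the total of its shifts by \<open>h < Q\<close>.
  Cauchy-Schwarz over the starting point leaves correlations that depend only on the difference of
  two shifts. Differences below \<open>Q0\<close> get the trivial bound \<open>K\<close>, which
  happens at most \<open>2 * Q0\<close> times per row; \<open>B\<close> covers the others.\<close>

theorem van_der_corput_inequality:
  fixes g :: "nat \<Rightarrow> real" and K :: real and a b Q Q0 :: nat
  assumes Q: "0 < Q" "Q \<le> a" "real Q \<le> K" and Q0: "0 < Q0" and len: "real (b - a) \<le> K"
    and B: "0 \<le> B"
    and corr: "\<And>q. Q0 \<le> q \<Longrightarrow> q < Q \<Longrightarrow> norm (\<Sum>n\<in>{a..<b - q}. cis (g (n + q) - g n)) \<le> B"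
  shows "(norm (\<Sum>n\<in>{a..<b}. cis (g n)))\<^sup>2 \<le> 4 * K\<^sup>2 * (Q0 / Q) + 2 * K * B"
proof -
  define z where "z n = (if n \<in> {a..<b} then cis (g n) else 0)" for n
  define S where "S = (\<Sum>n\<in>{a..<b}. cis (g n))"
  \<comment> \<open>The range begins \<open>Q\<close> places early so that every shift by
    \<open>h < Q\<close> still covers \<open>{a..<b}\<close>; \<open>Q \<le> a\<close> makes this
    subtraction of natural numbers exact.\<close>
  define I where "I = {a - Q..<b}"
  define C where "C h h' = (\<Sum>n\<in>I. z (n + h) * cnj (z (n + h')))" for h h'
  have shift: "(\<Sum>n\<in>I. z (n + h)) = S" if "h < Q" for h
  proof -
    have "(\<Sum>n\<in>I. z (n + h)) = (\<Sum>n\<in>(\<lambda>n. n + h) ` I. z n)"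
      by (simp add: sum.reindex inj_on_def)
    also have "(\<lambda>n. n + h) ` I = {a - Q + h..<b + h}"
      unfolding I_def by simp
    also have "(\<Sum>n\<in>{a - Q + h..<b + h}. z n) = (\<Sum>n\<in>{a..<b}. z n)"
      using that Q by (intro sum.mono_neutral_right) (auto simp: z_def)
    finally show ?thesis by (simp add: S_def z_def)
  qed
  have C_eq: "C (h' + q) h' = (\<Sum>n\<in>{a..<b - q}. cis (g (n + q) - g n))" if "h' < Q" for h' q
  proof -
    have "C (h' + q) h' = (\<Sum>n\<in>(\<lambda>n. n + h') ` I. z (n + q) * cnj (z n))"
      by (simp add: C_def sum.reindex inj_on_def ac_simps)
    also have "(\<lambda>n. n + h') ` I = {a - Q + h'..<b + h'}"
      unfolding I_def by simp
    also have "(\<Sum>n\<in>{a - Q + h'..<b + h'}. z (n + q) * cnj (z n))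
        = (\<Sum>n\<in>{a..<b - q}. z (n + q) * cnj (z n))"
      using that Q by (intro sum.mono_neutral_right) (auto simp: z_def)
    also have "\<dots> = (\<Sum>n\<in>{a..<b - q}. cis (g (n + q) - g n))"
      by (intro sum.cong) (auto simp: z_def cis_cnj cis_mult)
    finally show ?thesis .
  qed
  have C_sym: "C h h' = cnj (C h' h)" for h h'
    by (simp add: C_def ac_simps)
  have C_ordered: "norm (C h h') \<le> (if h < h' + Q0 then K else 0) + B"
    if "h' \<le> h" "h < Q" for h h'
  proof -
    define q where "q = h - h'"
    have h: "h = h' + q" using that by (simp add: q_def)
    have eq: "C h h' = (\<Sum>n\<in>{a..<b - q}. cis (g (n + q) - g n))"
      unfolding h using that by (intro C_eq) auto
    show ?thesis
    proof (cases "q < Q0")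
      case True
      have "norm (C h h') \<le> real (card {a..<b - q}) * 1"
        unfolding eq by (intro sum_norm_bound) auto
      also have "\<dots> \<le> real (b - a)" by simp
      finally show ?thesis using True len B h by simp
    next
      case False
      then show ?thesis
        using corr[of q] that h eq by auto
    qed
  qed
  have C_bound: "norm (C h h') \<le> (if h < h' + Q0 \<and> h' < h + Q0 then K else 0) + B"
    if "h < Q" "h' < Q" for h h'
  proof (cases "h' \<le> h")
    case True
    then show ?thesis using C_ordered[of h' h] that Q0 by (auto split: if_splits)
  next
    case False
    then have "norm (C h' h) \<le> (if h' < h + Q0 then K else 0) + B"
      using C_ordered[of h h'] that by auto
    moreover have "norm (C h h') = norm (C h' h)"
      by (subst C_sym) simp
    ultimately show ?thesis using False Q0 by (auto split: if_splits)
  qed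
  have K: "0 \<le> K" using len by linarith
  have row: "(\<Sum>h<Q. norm (C h h')) \<le> 2 * Q0 * K + Q * B" if "h' < Q" for h'
  proof -
    have "(\<Sum>h<Q. norm (C h h')) \<le> (\<Sum>h<Q. (if h < h' + Q0 \<and> h' < h + Q0 then K else 0) + B)"
      using that by (intro sum_mono C_bound) auto
    also have "\<dots> = real (card {h\<in>{..<Q}. h < h' + Q0 \<and> h' < h + Q0}) * K + Q * B"
      by (simp add: sum.distrib sum.If_cases Int_def)
    also have "card {h\<in>{..<Q}. h < h' + Q0 \<and> h' < h + Q0} \<le> card {h' - Q0..<h' + Q0}"
      by (intro card_mono) auto
    also have "card {h' - Q0..<h' + Q0} \<le> 2 * Q0" by simp
    finally show ?thesis using K by (simp add: mult_right_mono)
  qed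
  have "(\<Sum>n\<in>I. (norm (\<Sum>h<Q. z (n + h)))\<^sup>2) = norm (\<Sum>h'<Q. \<Sum>h<Q. C h h')"
  proof -
    have "complex_of_real (\<Sum>n\<in>I. (norm (\<Sum>h<Q. z (n + h)))\<^sup>2)
        = (\<Sum>n\<in>I. (\<Sum>h<Q. z (n + h)) * cnj (\<Sum>h<Q. z (n + h)))"
      by (simp add: complex_norm_square del: of_real_power)
    also have "\<dots> = (\<Sum>n\<in>I. \<Sum>h'<Q. \<Sum>h<Q. z (n + h) * cnj (z (n + h')))"
      by (simp add: sum_product) (subst sum.swap, simp)
    also have "\<dots> = (\<Sum>h'<Q. \<Sum>h<Q. C h h')"
      unfolding C_def by (subst sum.swap) (intro sum.cong refl sum.swap)
    finally have "complex_of_real (\<Sum>n\<in>I. (norm (\<Sum>h<Q. z (n + h)))\<^sup>2) = (\<Sum>h'<Q. \<Sum>h<Q. C h h')" .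
    from arg_cong[OF this, of norm] show ?thesis
      by (simp only: norm_of_real abs_of_nonneg sum_nonneg zero_le_power2)
  qed
  also have "\<dots> \<le> (\<Sum>h'<Q. 2 * Q0 * K + Q * B)"
    by (intro order.trans[OF norm_sum] sum_mono row) auto
  also have "\<dots> = Q * (2 * Q0 * K + Q * B)" by simp
  finally have energy: "(\<Sum>n\<in>I. (norm (\<Sum>h<Q. z (n + h)))\<^sup>2) \<le> Q * (2 * Q0 * K + Q * B)" .
  have "of_nat Q * S = (\<Sum>h<Q. \<Sum>n\<in>I. z (n + h))"
    by (simp add: shift)
  also have "\<dots> = (\<Sum>n\<in>I. \<Sum>h<Q. z (n + h))"
    by (rule sum.swap)
  finally have "(real Q * norm S)\<^sup>2 = (norm (\<Sum>n\<in>I. \<Sum>h<Q. z (n + h)))\<^sup>2"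
    by (metis norm_mult norm_of_nat)
  also have "\<dots> \<le> (\<Sum>n\<in>I. norm (\<Sum>h<Q. z (n + h)))\<^sup>2"
    by (intro power_mono norm_sum) auto
  also have "\<dots> \<le> (\<Sum>n\<in>I. (norm (\<Sum>h<Q. z (n + h)))\<^sup>2) * card I"
    by (intro sum_squared_le_sum_of_squares)
  also have "\<dots> \<le> (Q * (2 * Q0 * K + Q * B)) * (2 * K)"
  proof (intro mult_mono energy)
    show "real (card I) \<le> 2 * K"
      using len Q by (auto simp: I_def)
  qed (use B K in auto)
  also have "\<dots> = (4 * K\<^sup>2 * (Q0 / Q) + 2 * K * B) * (real Q)\<^sup>2"
    using Q by (simp add: power2_eq_square field_simps)
  finally have "(norm S)\<^sup>2 * (real Q)\<^sup>2 \<le> (4 * K\<^sup>2 * (Q0 / Q) + 2 * K * B) * (real Q)\<^sup>2"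
    by (simp add: power_mult_distrib mult.commute)
  then show ?thesis using Q by (simp add: S_def)
qed

section \<open>Iterated differences of the logarithm and the resulting power saving\<close>

fun iterated_diff :: "real list \<Rightarrow> (real \<Rightarrow> real) \<Rightarrow> real \<Rightarrow> real" where
  "iterated_diff [] f x = f x"
| "iterated_diff (q # qs) f x = iterated_diff qs f (x + q) - iterated_diff qs f x"

lemma has_real_derivative_iterated_diff:
  assumes "\<And>x. 0 < x \<Longrightarrow> (f has_real_derivative f' x) (at x)"
    and "\<And>q. q \<in> set qs \<Longrightarrow> 0 < q" and "0 < x"
  shows "(iterated_diff qs f has_real_derivative iterated_diff qs f' x) (at x)"
  using assms(2,3)
proof (induction qs arbitrary: x)
  case Nil
  have "iterated_diff [] g = g" for g by auto
  then show ?case using assms(1) Nil by simp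
next
  case (Cons q qs)
  have "0 < q" using Cons.prems by auto
  have "(iterated_diff qs f has_real_derivative iterated_diff qs f' (x + q)) (at (x + q))"
    and 2: "(iterated_diff qs f has_real_derivative iterated_diff qs f' x) (at x)"
    using Cons.IH[of "x + q"] Cons.IH[of x] Cons.prems \<open>0 < q\<close> by auto
  from this(1) have "((\<lambda>x. iterated_diff qs f (x + q)) has_real_derivative iterated_diff qs f' (x + q)) (at x)"
    by (simp add: DERIV_shift)
  from DERIV_diff[OF this 2] show ?case by simp
qed

text \<open>One application of the mean value theorem per shift, each to the function already
  differenced by the remaining shifts. Treating the derivatives as a family \<open>F\<close> lets
  the induction pass to the next order.\<close>

lemma iterated_diff_mean_value:
  fixes F :: "nat \<Rightarrow> real \<Rightarrow> real"
  assumes deriv: "\<And>s x. 0 < x \<Longrightarrow> (F s has_real_derivative F (Suc s) x) (at x)"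
    and "\<And>q. q \<in> set qs \<Longrightarrow> 0 < q" and "0 < x"
  shows "\<exists>\<xi>. x \<le> \<xi> \<and> \<xi> \<le> x + sum_list qs \<and>
    iterated_diff qs (F s) x = prod_list qs * F (s + length qs) \<xi>"
  using assms(2,3)
proof (induction qs arbitrary: s x)
  case Nil
  then show ?case by auto
next
  case (Cons q qs)
  have q: "0 < q" using Cons.prems by auto
  have "\<exists>z>x. z < x + q \<and> iterated_diff qs (F s) (x + q) - iterated_diff qs (F s) x
      = (x + q - x) * iterated_diff qs (F (Suc s)) z"
    by (rule MVT2) (use q Cons.prems in \<open>auto intro!: has_real_derivative_iterated_diff deriv\<close>)
  then obtain z where z: "x < z" "z < x + q"
    "iterated_diff (q # qs) (F s) x = q * iterated_diff qs (F (Suc s)) z"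
    by auto
  obtain \<xi> where "z \<le> \<xi>" "\<xi> \<le> z + sum_list qs"
    "iterated_diff qs (F (Suc s)) z = prod_list qs * F (Suc s + length qs) \<xi>"
    using Cons.IH[of z "Suc s"] Cons.prems z by auto
  then show ?case
    using z by (intro exI[of _ \<xi>]) auto
qed

fun ln_deriv :: "nat \<Rightarrow> real \<Rightarrow> real" where
  "ln_deriv 0 x = ln x"
| "ln_deriv (Suc s) x = (-1) ^ s * fact s / x ^ Suc s"

lemma has_real_derivative_ln_deriv:
  assumes "0 < x"
  shows "(ln_deriv s has_real_derivative ln_deriv (Suc s) x) (at x)"
proof (cases s)
  case 0
  have "ln_deriv 0 = ln" by auto
  then show ?thesis using assms 0 by (auto intro!: derivative_eq_intros)
next
  case (Suc r)
  have "ln_deriv (Suc r) = (\<lambda>x. (-1) ^ r * fact r / x ^ Suc r)" by auto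
  moreover have "((\<lambda>x. (-1) ^ r * fact r / x ^ Suc r) has_real_derivative
      - ((-1) ^ r * fact r * (Suc r * x ^ r)) / (x ^ Suc r * x ^ Suc r)) (at x)"
    using assms by (auto intro!: derivative_eq_intros simp del: power_Suc)
  moreover have "- ((-1) ^ r * fact r * (Suc r * x ^ r)) / (x ^ Suc r * x ^ Suc r) = ln_deriv (Suc s) x"
    using assms Suc by (simp add: field_simps)
  ultimately show ?thesis using Suc by simp
qed

text \<open>The derivative of order \<open>s + 1\<close> of \<open>ln\<close> has sign
  \<open>(-1)^s\<close>. The shift \<open>q\<close> is kept apart from \<open>qs\<close> because it
  will be 1: this extra difference is the phase increment that Kusmin-Landau asks for.\<close>

lemma iterated_diff_ln:
  fixes q :: real
  assumes "\<And>q. q \<in> set qs \<Longrightarrow> 0 < q" and "0 < q" "0 < x"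
  shows "\<exists>\<xi>. x \<le> \<xi> \<and> \<xi> \<le> x + q + sum_list qs \<and>
    (-1) ^ length qs * iterated_diff (q # qs) ln x = q * prod_list qs * fact (length qs) / \<xi> ^ Suc (length qs)"
proof -
  have ln: "ln_deriv 0 = ln" by auto
  obtain \<xi> where \<xi>: "x \<le> \<xi>" "\<xi> \<le> x + sum_list (q # qs)"
    "iterated_diff (q # qs) (ln_deriv 0) x = prod_list (q # qs) * ln_deriv (0 + length (q # qs)) \<xi>"
    using iterated_diff_mean_value[of ln_deriv "q # qs" x 0] has_real_derivative_ln_deriv assms
    by auto
  have "(-1) ^ length qs * iterated_diff (q # qs) ln x
      = ((-1) ^ length qs * (-1) ^ length qs) * (q * prod_list qs * fact (length qs) / \<xi> ^ Suc (length qs))"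
    using \<xi>(3) unfolding ln by (simp add: field_simps)
  also have "(-1) ^ length qs * (-1) ^ length qs = (1 :: real)"
    by (simp flip: power_mult_distrib)
  finally show ?thesis using \<xi>(1,2) by (intro exI[of _ \<xi>]) auto
qed

lemma norm_sum_cis_minus: "norm (\<Sum>n\<in>A. cis (- g n)) = norm (\<Sum>n\<in>A. cis (g n))"
proof -
  have "(\<Sum>n\<in>A. cis (- g n)) = cnj (\<Sum>n\<in>A. cis (g n))"
    by (simp add: cis_cnj)
  then show ?thesis by (simp only: complex_mod_cnj)
qed

lemma prod_list_bounds:
  fixes L U :: real
  assumes "0 \<le> L" "\<And>q. q \<in> set qs \<Longrightarrow> L \<le> q \<and> q \<le> U"
  shows "L ^ length qs \<le> prod_list qs" "prod_list qs \<le> U ^ length qs"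
proof -
  have "L ^ length qs \<le> prod_list qs \<and> prod_list qs \<le> U ^ length qs"
    using assms(2)
  proof (induction qs)
    case (Cons q qs)
    have "0 \<le> L ^ length qs" using assms(1) by simp
    then have "0 \<le> prod_list qs" using Cons by fastforce
    moreover have "L \<le> q" "q \<le> U" using Cons.prems by auto
    moreover from this have "0 \<le> q" "0 \<le> U" using assms(1) by linarith+
    ultimately show ?case using Cons assms(1) by (auto intro!: mult_mono)
  qed auto
  then show "L ^ length qs \<le> prod_list qs" "prod_list qs \<le> U ^ length qs" by auto
qed

text \<open>After \<open>r\<close> differencings the phase increment is, up to sign,
  \<open>t * fact r\<close> times the product of the shifts divided by \<open>\<xi> ^ Suc r\<close>,
  where \<open>small\<close> keeps \<open>\<xi>\<close> between \<open>K\<close> and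
  \<open>3 K\<close>. The condition on \<open>t\<close> bounds it by \<open>pi\<close>, its lower
  bound is \<open>\<theta>\<close>, and the next derivative gives monotonicity.\<close>

lemma differenced_log_sum_bound:
  fixes t :: real and K Q Q0 :: nat
  assumes K: "0 < K" "K \<le> a" "b \<le> 2 * K" and Q0: "0 < Q0"
    and qs: "set qs \<subseteq> {Q0..<Q}" "length qs = r" and small: "2 + r * Q \<le> K"
    and t: "0 < t" "t * fact r * real Q ^ r \<le> pi * real K ^ Suc r"
  shows "norm (\<Sum>n\<in>{a..<b}. cis (t * iterated_diff (map real qs) ln (real n)))
    \<le> 6 * (3 * real K) ^ Suc r / (t * real Q0 ^ r)"
proof -
  \<comment> \<open>The sign makes the increments positive. It is harmless, since conjugation leaves
    the norm of the sum unchanged.\<close>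
  define G where "G n = (-1) ^ r * (t * iterated_diff (map real qs) ln (real n))" for n :: nat
  define \<theta> where "\<theta> = t * real Q0 ^ r / (3 * real K) ^ Suc r"
  let ?qs = "map real qs"
  have pos: "0 < q" if "q \<in> set ?qs" for q
    using that qs Q0 by auto
  have len: "length ?qs = r" using qs by simp
  have prod: "real Q0 ^ r \<le> prod_list ?qs" "prod_list ?qs \<le> real Q ^ r"
    using prod_list_bounds[of "real Q0" ?qs "real Q"] qs by force+
  have prod_pos: "0 < prod_list ?qs"
    using prod(1) Q0 by (smt (verit) of_nat_0_less_iff zero_less_power)
  have sum: "sum_list ?qs \<le> r * Q"
    using sum_list_mono[of qs real "\<lambda>_. real Q"] qs by (force simp: sum_list_triv)
  have step: "G (Suc n) - G n = t * ((-1) ^ r * iterated_diff (1 # ?qs) ln n)" for n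
    by (simp add: G_def algebra_simps)
  have step2: "(G (Suc (Suc n)) - G (Suc n)) - (G (Suc n) - G n)
      = - (t * ((-1) ^ length (1 # ?qs) * iterated_diff (1 # 1 # ?qs) ln n))" for n
    using len by (simp add: G_def algebra_simps)
  have D: "\<theta> \<le> G (Suc n) - G n \<and> G (Suc n) - G n \<le> pi" if "a \<le> n" "n < b" for n
  proof -
    have n: "0 < real n" using that K by simp
    obtain \<xi> where \<xi>: "real n \<le> \<xi>" "\<xi> \<le> n + 1 + sum_list ?qs"
      "(-1) ^ r * iterated_diff (1 # ?qs) ln n = prod_list ?qs * fact r / \<xi> ^ Suc r"
      using iterated_diff_ln[of ?qs 1 n, OF pos] n unfolding len by auto
    have "real (2 + r * Q) \<le> real K" using small by (rule of_nat_mono)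
    moreover have "real n < 2 * K" using that K by linarith
    ultimately have \<xi>3: "real K \<le> \<xi>" "\<xi> \<le> 3 * real K" using \<xi> sum that K by auto
    have eq: "G (Suc n) - G n = t * prod_list ?qs * fact r / \<xi> ^ Suc r"
      unfolding step \<xi>(3) by simp
    have "t * real Q0 ^ r * 1 / (3 * real K) ^ Suc r \<le> t * prod_list ?qs * fact r / \<xi> ^ Suc r"
      using \<xi>3 K t prod prod_pos
      by (intro frac_le mult_mono power_mono zero_less_power) (auto intro: less_imp_le)
    moreover have "t * prod_list ?qs * fact r / \<xi> ^ Suc r \<le> t * real Q ^ r * fact r / real K ^ Suc r"
      using \<xi>3 K t prod prod_pos
      by (intro frac_le mult_mono power_mono zero_less_power) (auto intro: less_imp_le)
    moreover have "t * real Q ^ r * fact r / real K ^ Suc r \<le> pi"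
      using t K by (subst pos_divide_le_eq) (auto simp: mult_ac)
    ultimately show ?thesis unfolding eq \<theta>_def by linarith
  qed
  have decr: "G (Suc (Suc n)) - G (Suc n) \<le> G (Suc n) - G n" if "a \<le> n" "Suc n < b" for n
  proof -
    have n: "0 < real n" using that K by simp
    obtain \<xi> where \<xi>: "real n \<le> \<xi>"
      "(-1) ^ length (1 # ?qs) * iterated_diff (1 # 1 # ?qs) ln n
        = 1 * prod_list (1 # ?qs) * fact (length (1 # ?qs)) / \<xi> ^ Suc (length (1 # ?qs))"
      using iterated_diff_ln[of "1 # ?qs" 1 n] n pos by force
    have "0 \<le> (-1) ^ length (1 # ?qs) * iterated_diff (1 # 1 # ?qs) ln n"
      unfolding \<xi>(2) using \<xi>(1) n prod_pos by simp
    from mult_nonneg_nonneg[OF less_imp_le[OF t(1)] this]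
    have "0 \<le> t * ((-1) ^ length (1 # ?qs) * iterated_diff (1 # 1 # ?qs) ln n)" .
    then show ?thesis using step2[of n] by linarith
  qed
  have "norm (\<Sum>n\<in>{a..<b}. cis (G n)) \<le> 6 / \<theta>"
    by (rule kusmin_landau) (use D decr t Q0 K in \<open>auto simp: \<theta>_def\<close>)
  also have "norm (\<Sum>n\<in>{a..<b}. cis (G n))
      = norm (\<Sum>n\<in>{a..<b}. cis (t * iterated_diff (map real qs) ln (real n)))"
    unfolding G_def by (cases "even r") (auto simp: norm_sum_cis_minus)
  finally show ?thesis by (simp add: \<theta>_def)
qed

text \<open>Shifts below \<open>Q0\<close> are estimated trivially, which costs \<open>Q0 / Q\<close> at each differencing step; this
  keeps all remaining shifts of comparable size, so that one bound serves for all of them.\<close>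

lemma log_sum_bound_iterate:
  fixes t a :: real and K Q Q0 r :: nat
  assumes Q: "0 < Q0" "0 < Q" "Q \<le> K" and a: "real Q0 / real Q \<le> a" "a \<le> 1"
    and base: "\<And>qs lo hi. \<lbrakk>set qs \<subseteq> {Q0..<Q}; length qs = r; K \<le> lo; hi \<le> 2 * K\<rbrakk> \<Longrightarrow>
       norm (\<Sum>n\<in>{lo..<hi}. cis (t * iterated_diff (map real qs) ln (real n))) \<le> 5 * real K * a"
    and "s \<le> r" "set qs \<subseteq> {Q0..<Q}" "length qs = r - s" "K \<le> lo" "hi \<le> 2 * K"
  shows "norm (\<Sum>n\<in>{lo..<hi}. cis (t * iterated_diff (map real qs) ln (real n)))
     \<le> 5 * real K * a powr (1 / 2 ^ s)"
  using assms(7-)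
proof (induction s arbitrary: qs lo hi)
  case 0
  have "0 < real Q0 / real Q" using Q by simp
  then have "0 < a" using a by linarith
  then show ?case using base[of qs lo hi] 0 by simp
next
  case (Suc s)
  have "0 < real Q0 / real Q" using Q by simp
  then have a0: "0 < a" using a by linarith
  \<comment> \<open>Undoing one differencing halves the exponent of \<open>a\<close>. As
    \<open>a \<le> 1\<close>, the trivial contribution \<open>Q0 / Q\<close> stays below
    \<open>a'\<close> at every level.\<close>
  define a' where "a' = a powr (1 / 2 ^ s)"
  have "a powr 1 \<le> a'"
    unfolding a'_def using a a0 by (intro powr_mono') auto
  then have aa': "real Q0 / real Q \<le> a'" "0 \<le> a'" using a a0 by auto
  let ?g = "\<lambda>n::nat. t * iterated_diff (map real qs) ln (real n)"
  let ?S = "norm (\<Sum>n\<in>{lo..<hi}. cis (?g n))"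
  have "?S\<^sup>2 \<le> 4 * (real K)\<^sup>2 * (Q0 / Q) + 2 * real K * (5 * real K * a')"
  proof (rule van_der_corput_inequality)
    fix q assume q: "Q0 \<le> q" "q < Q"
    have "norm (\<Sum>n\<in>{lo..<hi - q}. cis (t * iterated_diff (map real (q # qs)) ln (real n)))
        \<le> 5 * real K * a'"
      unfolding a'_def using Suc.prems q by (intro Suc.IH) auto
    then show "norm (\<Sum>n\<in>{lo..<hi - q}. cis (?g (n + q) - ?g n)) \<le> 5 * real K * a'"
      by (simp add: algebra_simps)
  qed (use Q Suc.prems aa' in auto)
  also have "\<dots> \<le> 4 * (real K)\<^sup>2 * a' + 2 * real K * (5 * real K * a')"
    using aa' by (intro add_mono mult_left_mono) auto
  also have "\<dots> = 14 * ((real K)\<^sup>2 * a')"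
    by (simp add: power2_eq_square)
  \<comment> \<open>The constant 5 reproduces itself under the square root because
    \<open>4 + 2 * 5 \<le> 5 * 5\<close>.\<close>
  also have "\<dots> \<le> 25 * ((real K)\<^sup>2 * a')"
    using aa' by (intro mult_right_mono) auto
  also have "\<dots> = (5 * real K * a powr (1 / 2 ^ Suc s))\<^sup>2"
    using a0 by (simp add: power_mult_distrib a'_def power2_eq_square flip: powr_add)
  finally show ?case
    by (rule power2_le_imp_le) auto
qed

text \<open>With \<open>Q = Z ^ 10\<close> and \<open>Q0 = Z ^ 8\<close> the trivial loss is
  \<open>Z^(-2)\<close>. Kusmin-Landau saves a factor \<open>Z\<close> as soon as \<open>t\<close>
  exceeds a constant times \<open>Z ^ (42 * r + 1)\<close>, and its increments are admissible while
  \<open>t * fact r\<close> is at most \<open>pi * Z ^ (40 * r + 50)\<close>. One spare power of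
  \<open>Z\<close> at each end of the range absorbs the constants. Undoing \<open>r \<le> 3\<close>
  differencings turns \<open>1 / Z\<close> into at worst its eighth root.\<close>

lemma log_sum_bound_power_range:
  fixes t :: real and Z r :: nat
  assumes Z: "1000 \<le> Z" and r: "1 \<le> r" "r \<le> 3"
    and t: "real Z ^ (42 * r + 2) \<le> t" "t \<le> real Z ^ (40 * r + 49)"
    and K: "K = Z ^ 50" "K \<le> lo" "hi \<le> 2 * K"
  shows "norm (\<Sum>n\<in>{lo..<hi}. cis (t * ln (real n))) \<le> 5 * real K * (1 / real Z) powr (1 / 8)"
proof -
  define Q Q0 where "Q = Z ^ 10" and "Q0 = Z ^ 8"
  have t0: "0 < t"
    using t(1) Z by (smt (verit) of_nat_0_less_iff zero_less_power less_le_trans zero_less_numeral)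
  have fact: "fact r \<le> (6 :: real)"
    using fact_mono[of r 3, where 'a = real] r by (simp add: eval_nat_numeral)
  have three: "3 ^ Suc r \<le> (81 :: real)"
    using power_increasing[of "Suc r" 4 "3::real"] r by simp
  have "norm (\<Sum>n\<in>{lo..<hi}. cis (t * iterated_diff (map real []) ln (real n)))
      \<le> 5 * real K * (1 / real Z) powr (1 / 2 ^ r)"
  proof (rule log_sum_bound_iterate)
    show "0 < Q0" "0 < Q" using Z by (auto simp: Q_def Q0_def)
    show "Q \<le> K" unfolding Q_def K using Z by (intro power_increasing) auto
    have eq: "real Z ^ 10 = real Z ^ 8 * (real Z)\<^sup>2"
      by (simp flip: power_add)
    have "real Q0 / real Q = (1 / real Z)\<^sup>2"
      unfolding Q_def Q0_def of_nat_power eq power_divide power_one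
      using Z by (intro nonzero_divide_mult_cancel_left) auto
    also have "\<dots> \<le> (1 / real Z) ^ 1"
      using Z by (intro power_decreasing) auto
    finally show "real Q0 / real Q \<le> 1 / real Z" by simp
    show "1 / real Z \<le> 1" using Z by simp
  next
    fix qs :: "nat list" and lo hi
    assume *: "set qs \<subseteq> {Q0..<Q}" "length qs = r" "K \<le> lo" "hi \<le> 2 * K"
    have "norm (\<Sum>n\<in>{lo..<hi}. cis (t * iterated_diff (map real qs) ln (real n)))
        \<le> 6 * (3 * real K) ^ Suc r / (t * real Q0 ^ r)"
    proof (rule differenced_log_sum_bound[OF _ *(3,4) _ *(1,2) _ t0])
      show "0 < K" "0 < Q0" using Z by (auto simp: K Q0_def)
      have "2 + r * Q \<le> 2 * Z ^ 10 + 3 * Z ^ 10"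
        using r Z by (intro add_mono) (auto simp: Q_def)
      also have "\<dots> \<le> Z * Z ^ 10" using Z by simp
      also have "\<dots> \<le> K"
        unfolding K power_Suc[symmetric] using Z by (intro power_increasing) auto
      finally show "2 + r * Q \<le> K" .
      have "t * fact r * real Q ^ r \<le> real Z ^ (40 * r + 49) * real Z * (real Z ^ 10) ^ r"
        unfolding Q_def using t t0 fact Z by (intro mult_mono) auto
      also have "\<dots> = 1 * real K ^ Suc r"
        unfolding K of_nat_power power_mult[symmetric] power_add[symmetric]
          power_Suc2[symmetric] mult_1
        by (simp add: algebra_simps)
      also have "\<dots> \<le> pi * real K ^ Suc r"
        using pi_gt3 by (intro mult_right_mono) auto
      finally show "t * fact r * real Q ^ r \<le> pi * real K ^ Suc r" .
    qed
    also have "\<dots> \<le> 5 * real K * (1 / real Z)"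
    proof -
      have "6 * (3 * real K) ^ Suc r = 6 * 3 ^ Suc r * real K ^ Suc r"
        by (simp add: power_mult_distrib)
      also have "\<dots> \<le> 5 * real Z * real K ^ Suc r"
        using three Z by (intro mult_right_mono) auto
      also have "\<dots> = 5 * real K * (1 / real Z) * (real Z ^ (42 * r + 2) * real Q0 ^ r)"
      proof -
        have "real Z * real K ^ Suc r = real Z ^ (50 * r + 51)"
          by (simp add: K algebra_simps flip: power_mult power_Suc power_add)
        also have "\<dots> = real Z ^ (49 + (42 * r + 2) + 8 * r)"
          by (simp add: algebra_simps)
        also have "\<dots> = real Z ^ 49 * (real Z ^ (42 * r + 2) * real Q0 ^ r)"
          unfolding Q0_def of_nat_power power_mult[symmetric] power_add by simp
        also have "real Z ^ 49 = K * (1 / real Z)"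
        proof -
          have "real K = real Z * real Z ^ 49" by (simp add: K flip: power_Suc)
          then show ?thesis using Z by simp
        qed
        finally show ?thesis by simp
      qed
      also have "\<dots> \<le> 5 * real K * (1 / real Z) * (t * real Q0 ^ r)"
        using t by (intro mult_left_mono mult_right_mono) auto
      finally show ?thesis
        using t0 Z by (subst pos_divide_le_eq) (auto simp: Q0_def)
    qed
    finally show "norm (\<Sum>n\<in>{lo..<hi}. cis (t * iterated_diff (map real qs) ln (real n)))
        \<le> 5 * real K * (1 / real Z)" .
  qed (use K in auto)
  also have "(1 / real Z) powr (1 / 2 ^ r) \<le> (1 / real Z) powr (1 / 8)"
    using Z r power_increasing[of r 3 "2::real"]
    by (intro powr_mono') (auto simp: field_simps)
  finally show ?thesis by (simp add: mult_left_mono)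
qed

text \<open>The ranges of exponents for one, two and three differencings are 44 to 89, 86 to 129 and
  128 to 169; consecutive ones overlap.\<close>

lemma log_sum_bound:
  fixes t :: real and Z :: nat
  assumes Z: "1000 \<le> Z" and t: "real Z ^ 44 \<le> t" "t \<le> real Z ^ 169"
    and K: "K = Z ^ 50" "K \<le> lo" "hi \<le> 2 * K"
  shows "norm (\<Sum>n\<in>{lo..<hi}. cis (t * ln (real n))) \<le> 5 * real K * (1 / real Z) powr (1 / 8)"
proof -
  note bound = log_sum_bound_power_range[OF Z _ _ _ _ K]
  have "real Z ^ 86 \<le> real Z ^ 89" "real Z ^ 128 \<le> real Z ^ 129"
    using Z by (auto intro!: power_increasing)
  then consider "t \<le> real Z ^ 89" | "real Z ^ 86 \<le> t" "t \<le> real Z ^ 129" | "real Z ^ 128 \<le> t"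
    by linarith
  then show ?thesis
    using bound[of 1 t] bound[of 2 t] bound[of 3 t] t by cases auto
qed

section \<open>The sum over \<open>k\<close> with weight \<open>1 / k\<close>, at low and high
  frequencies\<close>

lemma norm_weighted_sum_le:
  fixes w :: "nat \<Rightarrow> real" and z :: "nat \<Rightarrow> complex"
  assumes w: "\<And>n. a \<le> n \<Longrightarrow> w (Suc n) \<le> w n" "\<And>n. 0 \<le> w n"
    and B: "\<And>m. a \<le> m \<Longrightarrow> m \<le> b \<Longrightarrow> norm (\<Sum>n\<in>{a..<m}. z n) \<le> B" and "a \<le> b"
  shows "norm (\<Sum>n\<in>{a..<b}. of_real (w n) * z n) \<le> w a * B"
proof -
  define S where "S m = (\<Sum>n\<in>{a..<m}. z n)" for m
  have "norm ((\<Sum>n\<in>{a..<m}. of_real (w n) * z n) - of_real (w m) * S m) \<le> (w a - w m) * B"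
    if "a \<le> m" "m \<le> b" for m
    using that
  proof (induction m rule: dec_induct)
    case base
    then show ?case by (simp add: S_def)
  next
    case (step m)
    have "(\<Sum>n\<in>{a..<Suc m}. of_real (w n) * z n) - of_real (w (Suc m)) * S (Suc m)
        = ((\<Sum>n\<in>{a..<m}. of_real (w n) * z n) - of_real (w m) * S m)
          + of_real (w m - w (Suc m)) * S (Suc m)"
      using step by (simp add: S_def algebra_simps)
    also have "norm \<dots> \<le> (w a - w m) * B + (w m - w (Suc m)) * B"
    proof (rule order.trans[OF norm_triangle_ineq add_mono])
      show "norm (of_real (w m - w (Suc m)) * S (Suc m)) \<le> (w m - w (Suc m)) * B"
        unfolding norm_mult norm_of_real using w(1)[of m] B[of "Suc m"] step
        by (intro mult_mono) (auto simp: S_def)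
    qed (use step in auto)
    finally show ?case by (simp add: algebra_simps)
  qed
  from this[OF \<open>a \<le> b\<close> order.refl]
  have "norm (((\<Sum>n\<in>{a..<b}. of_real (w n) * z n) - of_real (w b) * S b) + of_real (w b) * S b)
      \<le> (w a - w b) * B + w b * B"
  proof (rule order.trans[OF norm_triangle_ineq add_mono])
    show "norm (of_real (w b) * S b) \<le> w b * B"
      unfolding norm_mult norm_of_real using w(2)[of b] B[OF \<open>a \<le> b\<close> order.refl]
      by (intro mult_mono) (auto simp: S_def)
  qed
  then show ?thesis by (simp add: algebra_simps)
qed

lemma norm_cis_minus_linear_le:
  fixes x :: real
  shows "norm (cis x - 1 - \<i> * of_real x) \<le> x\<^sup>2"
proof -
  have "1 - cos x = 2 * (sin (x / 2))\<^sup>2"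
    using cos_double_sin[of "x / 2"] by simp
  also have "\<dots> \<le> 2 * (x / 2)\<^sup>2"
    using abs_sin_x_le_abs_x[of "x / 2"] by (intro mult_left_mono) (simp_all only: abs_le_square_iff)
  finally have "\<bar>cos x - 1\<bar> \<le> x\<^sup>2 / 2"
    using cos_le_one[of x] by (simp add: power2_eq_square)
  moreover have "\<bar>sin x - x\<bar> \<le> x\<^sup>2 / 2"
    using Maclaurin_sin_bound[of x 2] by (simp add: eval_nat_numeral sin_coeff_def)
  ultimately show ?thesis
    using cmod_le[of "cis x - 1 - \<i> * of_real x"] by simp
qed

text \<open>The frequencies \<open>2\<pi>j / ln 2\<close> are those at which \<open>y\<^sup>i\<^sup>t\<close> takes the same value at \<open>K\<close> and
  \<open>2K\<close>, so that the integral of \<open>y\<^sup>i\<^sup>t / y\<close> over \<open>[K, 2K]\<close> vanishes.\<close>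

lemma reciprocal_log_sum_small_frequency:
  fixes K j :: nat
  assumes K: "0 < K" and j: "0 < j" and t: "t = 2 * pi / ln 2 * real j"
  shows "norm (\<Sum>k\<in>{K..<2 * K}. of_real (1 / real k) * cis (t * ln (real k))) \<le> (t + 1) / K"
proof -
  define S where "S = (\<Sum>k\<in>{K..<2 * K}. of_real (1 / real k) * cis (t * ln (real k)))"
  \<comment> \<open>\<open>e k\<close> is the error in replacing a unit difference of
    \<open>y^(it)\<close> by its derivative \<open>i t y^(it - 1)\<close> at \<open>k\<close>.
    Summed over \<open>k\<close> the differences telescope to zero, so \<open>t * norm S\<close> is
    at most the total error.\<close>
  define e where "e k = cis (t * ln (real (Suc k))) - cis (t * ln (real k))
      - \<i> * of_real t * (of_real (1 / real k) * cis (t * ln (real k)))" for k :: nat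
  have t0: "0 < t" using j by (simp add: t)
  have e: "norm (e k) \<le> (t\<^sup>2 + t) / (real K)\<^sup>2" if "K \<le> k" for k
  proof -
    have k: "0 < real k" "real K \<le> real k" "1 \<le> k" using K that by auto
    define \<delta> where "\<delta> = t * ln (1 + 1 / real k)"
    have ln: "ln (real (Suc k)) = ln (real k) + ln (1 + 1 / real k)"
    proof -
      have "real (Suc k) = real k * (1 + 1 / real k)" using k by (simp add: field_simps)
      moreover have "0 < 1 + 1 / real k" using k by (simp add: add_pos_nonneg)
      ultimately show ?thesis using k ln_mult_pos by metis
    qed
    have "e k = cis (t * ln (real k)) * (cis \<delta> - 1 - \<i> * of_real (t / k))"
      unfolding e_def ln \<delta>_def
      by (simp add: algebra_simps flip: cis_mult)
    then have "norm (e k) = norm (cis \<delta> - 1 - \<i> * of_real (t / k))"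
      by (simp only: norm_mult norm_cis mult_1)
    also have "cis \<delta> - 1 - \<i> * of_real (t / k)
        = (cis \<delta> - 1 - \<i> * of_real \<delta>) + \<i> * of_real (\<delta> - t / k)"
      by (simp add: algebra_simps)
    also have "norm ((cis \<delta> - 1 - \<i> * of_real \<delta>) + \<i> * of_real (\<delta> - t / k)) \<le> \<delta>\<^sup>2 + \<bar>\<delta> - t / k\<bar>"
      by (rule order.trans[OF norm_triangle_ineq add_mono[OF norm_cis_minus_linear_le]])
         (simp only: norm_mult norm_of_real norm_ii mult_1 order.refl)
    also have "\<delta>\<^sup>2 \<le> (t / k)\<^sup>2"
    proof (rule power_mono)
      show "\<delta> \<le> t / k"
        unfolding \<delta>_def using ln_add_one_self_le_self[of "1 / real k"] t0 k
        by (simp add: mult_left_mono divide_inverse)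
      show "0 \<le> \<delta>" unfolding \<delta>_def using t0 k by simp
    qed
    also have "\<bar>\<delta> - t / k\<bar> = t * \<bar>ln (1 + 1 / real k) - 1 / real k\<bar>"
    proof -
      have "\<delta> - t / k = t * (ln (1 + 1 / real k) - 1 / real k)"
        by (simp add: \<delta>_def right_diff_distrib)
      then show ?thesis using t0 by (simp add: abs_mult)
    qed
    also have "\<dots> \<le> t * (1 / real k)\<^sup>2"
      using t0 k by (intro mult_left_mono abs_ln_one_plus_x_minus_x_bound_nonneg) auto
    also have "(t / k)\<^sup>2 + t * (1 / real k)\<^sup>2 = (t\<^sup>2 + t) / (real k)\<^sup>2"
      using k by (simp add: field_simps)
    also have "\<dots> \<le> (t\<^sup>2 + t) / (real K)\<^sup>2"
      using k K t0 by (intro divide_left_mono power_mono) auto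
    finally show ?thesis by simp
  qed
  have "(\<Sum>k\<in>{K..<2 * K}. e k) = (cis (t * ln (real (2 * K))) - cis (t * ln (real K))) - \<i> * of_real t * S"
    unfolding e_def S_def
      sum_subtractf[of "\<lambda>k. cis (t * ln (real (Suc k))) - cis (t * ln (real k))"]
      sum_distrib_left[symmetric]
    using sum_Suc_diff'[of K "2 * K" "\<lambda>k. cis (t * ln (real k))"] by simp
  also have "cis (t * ln (real (2 * K))) = cis (t * ln (real K))"
  proof -
    have "t * ln (real (2 * K)) = 2 * pi * real j + t * ln (real K)"
      using K by (simp add: ln_mult t field_simps)
    also have "cis \<dots> = cis (2 * pi * real j) * cis (t * ln (real K))"
      by (simp only: cis_mult)
    also have "cis (2 * pi * real j) = 1" by (rule cis_multiple_2pi) auto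
    finally show ?thesis by simp
  qed
  finally have "t * norm S = norm (\<Sum>k\<in>{K..<2 * K}. e k)"
    using t0 by (simp add: norm_mult)
  also have "\<dots> \<le> real (card {K..<2 * K}) * ((t\<^sup>2 + t) / (real K)\<^sup>2)"
    by (intro sum_norm_bound e) auto
  also have "\<dots> = t * ((t + 1) / K)"
    using K by (simp add: power2_eq_square field_simps)
  finally show ?thesis
    unfolding S_def[symmetric] using t0 by (simp only: mult_le_cancel_left_pos)
qed

text \<open>The threshold \<open>Z ^ 44\<close> is where the differencing range starts. Below it the
  estimate \<open>(t + 1) / K\<close> already gives \<open>5 / Z ^ 6\<close>; above it summation by
  parts transfers the unweighted bound, the weight at \<open>K\<close> cancelling the factor
  \<open>K\<close>.\<close>

theorem reciprocal_log_sum_bound: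
  fixes Z j :: nat
  assumes Z: "1000 \<le> Z" and K: "K = Z ^ 50" and j: "0 < j"
    and t: "t = 2 * pi / ln 2 * real j" "t \<le> real Z ^ 169"
  shows "norm (\<Sum>k\<in>{K..<2 * K}. of_real (1 / real k) * cis (t * ln (real k)))
    \<le> 5 * (1 / real Z) powr (1 / 8)"
proof (cases "t \<le> real Z ^ 44")
  case True
  have K0: "0 < K" using Z by (simp add: K)
  have "norm (\<Sum>k\<in>{K..<2 * K}. of_real (1 / real k) * cis (t * ln (real k))) \<le> (t + 1) / K"
    by (rule reciprocal_log_sum_small_frequency[OF K0 j t(1)])
  also have "\<dots> \<le> (5 * real Z ^ 44) / K"
  proof (intro divide_right_mono)
    have "1 \<le> real Z ^ 44" using Z by (intro one_le_power) auto
    then show "t + 1 \<le> 5 * real Z ^ 44" using True by linarith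
  qed auto
  also have "\<dots> = 5 * (1 / real Z) ^ 6"
  proof -
    have eq: "real Z ^ 50 = real Z ^ 44 * real Z ^ 6" by (simp flip: power_add)
    have "real Z ^ 44 / (real Z ^ 44 * real Z ^ 6) = 1 / real Z ^ 6"
      using Z by (intro nonzero_divide_mult_cancel_left) auto
    then show ?thesis
      unfolding K of_nat_power eq power_divide power_one times_divide_eq_right[symmetric] by simp
  qed
  also have "\<dots> = 5 * (1 / real Z) powr 6"
    by simp
  also have "\<dots> \<le> 5 * (1 / real Z) powr (1 / 8)"
    using Z by (intro mult_left_mono powr_mono') auto
  finally show ?thesis .
next
  case False
  have K0: "0 < K" using Z by (simp add: K)
  have "norm (\<Sum>k\<in>{K..<2 * K}. of_real (1 / real k) * cis (t * ln (real k)))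
      \<le> 1 / real K * (5 * real K * (1 / real Z) powr (1 / 8))"
  proof (rule norm_weighted_sum_le)
    fix m assume "K \<le> m" "m \<le> 2 * K"
    then show "norm (\<Sum>n\<in>{K..<m}. cis (t * ln (real n))) \<le> 5 * real K * (1 / real Z) powr (1 / 8)"
      using False t by (intro log_sum_bound[OF Z _ _ K]) auto
  qed (use K0 in \<open>auto intro: divide_left_mono\<close>)
  then show ?thesis using K0 by simp
qed

section \<open>The divisor bound\<close>

lemma card_divisors_mult_le:
  fixes a b :: nat
  assumes "0 < a" "0 < b"
  shows "card {d. d dvd a * b} \<le> card {d. d dvd a} * card {d. d dvd b}"
proof -
  have fin: "finite ({d. d dvd a} \<times> {d. d dvd b})"
    using assms by (intro finite_cartesian_product finite_divisors_nat)
  have "{d. d dvd a * b} \<subseteq> (\<lambda>(x, y). x * y) ` ({d. d dvd a} \<times> {d. d dvd b})"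
    using division_decomp by force
  then have "card {d. d dvd a * b} \<le> card ((\<lambda>(x, y). x * y) ` ({d. d dvd a} \<times> {d. d dvd b}))"
    using fin by (intro card_mono finite_imageI)
  also have "\<dots> \<le> card ({d. d dvd a} \<times> {d. d dvd b})"
    using fin by (rule card_image_le)
  finally show ?thesis by (simp add: card_cartesian_product)
qed

lemma card_divisors_prime_power_le:
  fixes p :: nat
  assumes "prime p"
  shows "card {d. d dvd p ^ e} \<le> Suc e"
proof -
  have "{d. d dvd p ^ e} \<subseteq> (\<lambda>i. p ^ i) ` {..e}"
    using assms by (auto simp: divides_primepow_nat)
  then have "card {d. d dvd p ^ e} \<le> card ((\<lambda>i. p ^ i) ` {..e})"
    by (intro card_mono) auto
  also have "\<dots> \<le> card {..e}" by (rule card_image_le) auto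
  finally show ?thesis by simp
qed

text \<open>A factor \<open>p ^ e\<close> contributes at most \<open>e + 1\<close>, which is at most
  \<open>p^(\<epsilon> e)\<close> once \<open>p \<ge> 2^(1/\<epsilon>)\<close>. Each smaller prime
  costs an extra factor \<open>C\<close>, and there are fewer than \<open>R\<close> of them, so the
  total loss is bounded independently of \<open>n\<close>.\<close>

theorem divisor_bound:
  fixes \<epsilon> :: real
  assumes \<epsilon>: "0 < \<epsilon>"
  shows "\<exists>C>0. \<forall>n>0. real (card {d. d dvd n}) \<le> C * real n powr \<epsilon>"
proof -
  \<comment> \<open>Chosen so that \<open>C \<ge> 1\<close> and
    \<open>C * \<epsilon> * ln 2 \<ge> 1\<close>, whence
    \<open>1 + e \<le> C * (1 + \<epsilon> * e * ln 2)\<close>.\<close>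
  define C where "C = 1 + 1 / (\<epsilon> * ln 2)"
  define R where "R = nat \<lceil>2 powr (1 / \<epsilon>)\<rceil>"
  define S where "S n = {p. prime p \<and> p < R \<and> p dvd n}" for n :: nat
  have C1: "1 \<le> C" using \<epsilon> by (simp add: C_def)
  have small: "real (Suc e) \<le> C * real p powr (\<epsilon> * e)" if "2 \<le> p" for e p :: nat
  proof -
    have "1 + real e \<le> C * (1 + \<epsilon> * e * ln 2)"
      using \<epsilon> by (simp add: C_def field_simps)
    also have "1 + \<epsilon> * e * ln 2 \<le> 2 powr (\<epsilon> * e)"
      by (simp add: powr_def)
    also have "2 powr (\<epsilon> * e) \<le> real p powr (\<epsilon> * e)"
      using that \<epsilon> by (intro powr_mono2) auto
    finally show ?thesis using C1 by simp
  qed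
  have large: "real (Suc e) \<le> real p powr (\<epsilon> * e)" if "R \<le> p" for e p :: nat
  proof -
    have "Suc e \<le> 2 ^ e" by (induction e) auto
    then have "real (Suc e) \<le> 2 powr real e"
      by (metis numeral_power_eq_of_nat_cancel_iff of_nat_mono powr_realpow zero_less_numeral of_nat_numeral of_nat_power)
    also have "2 powr real e = (2 powr (1 / \<epsilon>)) powr (\<epsilon> * e)"
      using \<epsilon> by (simp add: powr_powr)
    also have "\<dots> \<le> real p powr (\<epsilon> * e)"
      using that \<epsilon> by (intro powr_mono2) (auto simp: R_def)
    finally show ?thesis .
  qed
  have bound: "real (card {d. d dvd n}) \<le> C ^ card (S n) * real n powr \<epsilon>" if "0 < n" for n
    using that
  proof (induction n rule: less_induct)
    case (less n)
    show ?case
    proof (cases "n = 1")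
      case True
      then show ?thesis using C1 by (simp add: one_le_power)
    next
      case False
      then obtain p where p: "prime p" "p dvd n" using prime_factor_nat by blast
      \<comment> \<open>The whole power of \<open>p\<close> is split off, so \<open>p\<close> is
        absent from \<open>S m\<close> and a small prime is charged the factor \<open>C\<close> only
        once.\<close>
      define e where "e = multiplicity p n"
      obtain m where m: "n = p ^ e * m" "\<not> p dvd m"
        using multiplicity_decompose'[of n p] less.prems p e_def
        by (metis not_prime_unit less_numeral_extra(3))
      have e0: "0 < e" using p less.prems by (simp add: e_def prime_multiplicity_gt_zero_iff)
      have p2: "2 \<le> p" using p prime_ge_2_nat by blast
      have m0: "0 < m" using m less.prems by (auto intro: Nat.gr0I)
      have "1 < p ^ e" using p2 e0 by (intro one_less_power) auto
      then have mn: "m < n" using m m0 by simp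
      have fin: "finite (S n)" by (auto simp: S_def)
      have "real (card {d. d dvd n}) \<le> real (card {d. d dvd p ^ e} * card {d. d dvd m})"
        unfolding m(1) using m0 p2 by (intro of_nat_mono card_divisors_mult_le) auto
      also have "\<dots> \<le> real (Suc e) * (C ^ card (S m) * real m powr \<epsilon>)"
        unfolding of_nat_mult using less.IH[OF mn m0] card_divisors_prime_power_le[OF p(1), of e]
        by (intro mult_mono) auto
      also have "\<dots> \<le> (C ^ card (S n) * real (p ^ e) powr \<epsilon>) * real m powr \<epsilon>"
      proof -
        have pe: "real (p ^ e) powr \<epsilon> = real p powr (\<epsilon> * e)"
          using p2 by (simp add: powr_powr mult.commute flip: powr_realpow)
        have "real (Suc e) * C ^ card (S m) \<le> C ^ card (S n) * real p powr (\<epsilon> * e)"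
        proof (cases "p < R")
          case True
          have "insert p (S m) \<subseteq> S n" using True p m by (auto simp: S_def)
          then have "card (insert p (S m)) \<le> card (S n)" by (rule card_mono[OF fin])
          moreover have "p \<notin> S m" "finite (S m)" using m by (auto simp: S_def)
          ultimately have "Suc (card (S m)) \<le> card (S n)" by simp
          then have "C ^ Suc (card (S m)) \<le> C ^ card (S n)"
            by (rule power_increasing[OF _ C1])
          moreover have "real (Suc e) * C ^ card (S m) \<le> (C * real p powr (\<epsilon> * e)) * C ^ card (S m)"
            using small[OF p2, of e] C1 by (intro mult_right_mono) auto
          moreover have "\<dots> = C ^ Suc (card (S m)) * real p powr (\<epsilon> * e)" by simp
          ultimately show ?thesis
            by (smt (verit, best) mult_right_mono powr_ge_zero)
        next
          case False
          have "card (S m) \<le> card (S n)" using m by (intro card_mono[OF fin]) (auto simp: S_def)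
          then have "C ^ card (S m) \<le> C ^ card (S n)" by (rule power_increasing[OF _ C1])
          then have "real (Suc e) * C ^ card (S m) \<le> real p powr (\<epsilon> * e) * C ^ card (S n)"
            using large[of p e] False C1 by (intro mult_mono) auto
          then show ?thesis by (simp add: mult.commute)
        qed
        then show ?thesis unfolding pe by (simp add: mult_right_mono flip: mult.assoc)
      qed
      also have "\<dots> = C ^ card (S n) * real n powr \<epsilon>"
        unfolding m(1) by (simp add: powr_mult)
      finally show ?thesis .
    qed
  qed
  have "real (card {d. d dvd n}) \<le> C ^ R * real n powr \<epsilon>" if "0 < n" for n
  proof -
    have "card (S n) \<le> card {..<R}" by (intro card_mono) (auto simp: S_def)
    then have "C ^ card (S n) \<le> C ^ R" using C1 by (intro power_increasing) auto
    then show ?thesis using bound[OF that] by (smt (verit, best) mult_right_mono powr_ge_zero)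
  qed
  moreover have "0 < C ^ R" using C1 by simp
  ultimately show ?thesis by blast
qed

text \<open>A triple with product \<open>m\<close> is determined by its first two entries, both
  divisors of \<open>m\<close>; hence each fibre of the product map has at most \<open>t\<close>
  squared elements.\<close>

lemma card_triple_products_ge:
  fixes A B C :: "nat set"
  assumes fin: "finite A" "finite B" "finite C" and pos: "0 \<notin> A" "0 \<notin> B" "0 \<notin> C"
    and d: "\<And>a b c. a \<in> A \<Longrightarrow> b \<in> B \<Longrightarrow> c \<in> C \<Longrightarrow> card {d. d dvd a * b * c} \<le> t"
  shows "card A * card B * card C \<le> t\<^sup>2 * card ((\<lambda>(a, b, c). a * b * c) ` (A \<times> B \<times> C))"
proof -
  let ?f = "\<lambda>(a, b, c). a * b * c"
  let ?T = "A \<times> B \<times> C"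
  have finT: "finite ?T" using fin by auto
  have fibre: "card {x \<in> ?T. ?f x = m} \<le> t\<^sup>2" if m: "m \<in> ?f ` ?T" for m
  proof -
    have m0: "0 < m" and dm: "card {d. d dvd m} \<le> t" using m pos d by (auto intro!: Nat.gr0I)
    have "card {x \<in> ?T. ?f x = m} \<le> card ({d. d dvd m} \<times> {d. d dvd m})"
    proof (rule card_inj_on_le)
      show "inj_on (\<lambda>(a, b, c). (a, b)) {x \<in> ?T. ?f x = m}"
        using m0 by (auto simp: inj_on_def)
      show "finite ({d. d dvd m} \<times> {d. d dvd m})"
        using m0 by (intro finite_cartesian_product finite_divisors_nat)
    qed auto
    also have "\<dots> \<le> t\<^sup>2"
      unfolding card_cartesian_product power2_eq_square using dm by (intro mult_mono) auto
    finally show ?thesis .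
  qed
  have "?T = (\<Union>m\<in>?f ` ?T. {x \<in> ?T. ?f x = m})" by auto
  then have "card ?T \<le> (\<Sum>m\<in>?f ` ?T. card {x \<in> ?T. ?f x = m})"
    using card_UN_le[of "?f ` ?T" "\<lambda>m. {x \<in> ?T. ?f x = m}"] finT by simp
  also have "\<dots> \<le> (\<Sum>m\<in>?f ` ?T. t\<^sup>2)" by (intro sum_mono fibre)
  finally show ?thesis by (simp add: card_cartesian_product mult.commute mult.left_commute)
qed

section \<open>Fourier analysis on the logarithmic circle\<close>

text \<open>The slope 1/2 is weaker than the sharp \<open>2 / pi\<close> but suffices. Up to
  \<open>pi / 3\<close> it follows from \<open>x * cos x \<le> sin x\<close>; beyond, from
  \<open>sin (pi / 3) \<ge> 4 / 5 \<ge> pi / 4\<close>.\<close>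

lemma half_le_sin:
  fixes x :: real
  assumes "0 \<le> x" "x \<le> pi / 2"
  shows "x / 2 \<le> sin x"
proof (cases "x \<le> pi / 3")
  case True
  show ?thesis
  proof (cases "x = 0")
    case False
    then have x: "0 < x" "0 < sin x" using assms by (auto intro!: sin_gt_zero)
    have "cos (pi / 3) \<le> cos x"
      using True assms by (intro cos_monotone_0_pi_le) auto
    then have "x * (1 / 2) \<le> x * cos x"
      using assms by (intro mult_left_mono) (auto simp: cos_60)
    then have "x / 2 \<le> x * cos x" by simp
    also have "\<dots> \<le> sin x"
      using cot_le_inverse[of x] x assms by (simp add: cot_def field_simps)
    finally show ?thesis .
  qed auto
next
  case False
  have "x / 2 \<le> 4 / 5" using assms pi_approx by simp
  also have "8 / 5 \<le> sqrt 3" by (rule real_le_rsqrt) (simp add: power2_eq_square)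
  then have "4 / 5 \<le> sqrt 3 / 2" by simp
  also have "\<dots> = sin (pi / 3)" by (simp add: sin_60)
  also have "\<dots> \<le> sin x" using False assms by (intro sin_monotone_2pi_le) auto
  finally show ?thesis .
qed

lemma norm_one_minus_cis: "norm (1 - cis \<theta>) = 2 * \<bar>sin (\<theta> / 2)\<bar>"
proof (rule power2_eq_imp_eq)
  have "(norm (1 - cis \<theta>))\<^sup>2 = (1 - cos \<theta>)\<^sup>2 + (sin \<theta>)\<^sup>2"
    by (simp add: cmod_power2)
  also have "\<dots> = 2 * (1 - cos \<theta>)"
    using sin_cos_squared_add[of \<theta>] by (simp add: power2_eq_square algebra_simps)
  also have "1 - cos \<theta> = 2 * (sin (\<theta> / 2))\<^sup>2"
    using cos_double_sin[of "\<theta> / 2"] by simp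
  finally show "(norm (1 - cis \<theta>))\<^sup>2 = (2 * \<bar>sin (\<theta> / 2)\<bar>)\<^sup>2"
    by (simp add: power_mult_distrib)
qed auto

lemma norm_sum_cis_multiples_le:
  "norm (\<Sum>a<n. cis (real a * \<theta>)) * \<bar>sin (\<theta> / 2)\<bar> \<le> 1"
proof -
  have "cis (real a * \<theta>) = cis \<theta> ^ a" for a by (rule Complex.DeMoivre[symmetric])
  then have "(1 - cis \<theta>) * (\<Sum>a<n. cis (real a * \<theta>)) = 1 - cis \<theta> ^ n"
    unfolding one_diff_power_eq by presburger
  then have "norm (1 - cis \<theta>) * norm (\<Sum>a<n. cis (real a * \<theta>)) = norm (1 - cis \<theta> ^ n)"
    by (metis norm_mult)
  also have "\<dots> \<le> 2"
    using norm_triangle_ineq4[of 1 "cis \<theta> ^ n"] by (simp add: norm_power)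
  finally show ?thesis
    by (simp add: norm_one_minus_cis mult.commute)
qed

lemma sum_inverse_squares_le: "(\<Sum>d=1..n. 1 / (real d)\<^sup>2) \<le> 2"
proof -
  have "(\<Sum>d=1..n. 1 / (real d)\<^sup>2) \<le> 2 - 1 / real n" if "0 < n"
    using that
  proof (induction n rule: nat_induct_non_zero)
    case (Suc n)
    have "1 / (real (Suc n))\<^sup>2 \<le> 1 / (real n * real (Suc n))"
      using Suc by (intro divide_left_mono) (auto simp: power2_eq_square)
    also have "\<dots> = 1 / real n - 1 / real (Suc n)"
      using Suc by (simp add: field_simps)
    finally show ?case using Suc by simp
  qed simp
  moreover have "0 \<le> 1 / real n" by simp
  ultimately show ?thesis by (cases "n = 0") (simp, linarith)
qed

text \<open>On either side of \<open>m\<close> the distances are distinct positive integers, so each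
  side contributes at most 2.\<close>

lemma sum_inverse_square_distances_le:
  fixes M :: "nat set"
  assumes "finite M"
  shows "(\<Sum>m'\<in>M - {m}. 1 / (real m - real m')\<^sup>2) \<le> 4"
proof -
  have half: "(\<Sum>m'\<in>N. 1 / (real m - real m')\<^sup>2) \<le> 2"
    if "finite N" "inj_on f N" "\<And>x. x \<in> N \<Longrightarrow> 1 \<le> f x \<and> (real m - real x)\<^sup>2 = (real (f x))\<^sup>2"
    for N and f :: "nat \<Rightarrow> nat"
  proof -
    have "(\<Sum>m'\<in>N. 1 / (real m - real m')\<^sup>2) = (\<Sum>d\<in>f ` N. 1 / (real d)\<^sup>2)"
      using that by (simp add: sum.reindex)
    also have "\<dots> \<le> (\<Sum>d=1..Max (f ` N \<union> {1}). 1 / (real d)\<^sup>2)"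
      using that by (intro sum_mono2) auto
    also have "\<dots> \<le> 2" by (rule sum_inverse_squares_le)
    finally show ?thesis .
  qed
  have split: "M - {m} = {x\<in>M. m < x} \<union> {x\<in>M. x < m}" by auto
  have "(\<Sum>m'\<in>M - {m}. 1 / (real m - real m')\<^sup>2)
      = (\<Sum>m'\<in>{x\<in>M. m < x}. 1 / (real m - real m')\<^sup>2) + (\<Sum>m'\<in>{x\<in>M. x < m}. 1 / (real m - real m')\<^sup>2)"
    unfolding split using assms by (intro sum.union_disjoint) auto
  also have "\<dots> \<le> 2 + 2"
  proof (rule add_mono)
    show "(\<Sum>m'\<in>{x\<in>M. m < x}. 1 / (real m - real m')\<^sup>2) \<le> 2"
      by (rule half[of _ "\<lambda>x. x - m"])
        (use assms in \<open>auto simp: inj_on_def power2_eq_iff of_nat_diff\<close>)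
    show "(\<Sum>m'\<in>{x\<in>M. x < m}. 1 / (real m - real m')\<^sup>2) \<le> 2"
      by (rule half[of _ "\<lambda>x. m - x"])
        (use assms in \<open>auto simp: inj_on_def of_nat_diff\<close>)
  qed
  finally show ?thesis by simp
qed

section \<open>The large sieve at logarithmic frequencies\<close>

definition log_freq :: real where "log_freq = 2 * pi / ln 2"

lemma log_freq_ge: "8 \<le> log_freq"
  using pi_gt3 ln2_le_25_over_36 by (simp add: log_freq_def field_simps)

lemma log_freq_mult_ln2: "log_freq * ln 2 = 2 * pi"
  by (simp add: log_freq_def)

lemma abs_ln_diff_ge:
  fixes a b c :: real
  assumes "0 < a" "0 < b" "a \<le> c" "b \<le> c"
  shows "\<bar>a - b\<bar> / c \<le> \<bar>ln a - ln b\<bar>"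
proof -
  have *: "(b - a) / c \<le> ln b - ln a" if "0 < a" "a \<le> b" "b \<le> c" for a b :: real
  proof -
    have "ln a - ln b \<le> (a - b) / b"
      using that by (intro ln_diff_le) auto
    then have "(b - a) / b \<le> ln b - ln a"
      using that by (simp add: field_simps)
    moreover have "(b - a) / c \<le> (b - a) / b"
      using that by (intro divide_left_mono) auto
    ultimately show ?thesis by linarith
  qed
  show ?thesis
    using *[of a b] *[of b a] assms ln_le_cancel_iff[of a b] ln_le_cancel_iff[of b a]
    by (cases "a \<le> b") auto
qed

lemma norm_power2_sum: "complex_of_real ((norm (\<Sum>i\<in>I. f i))\<^sup>2) = (\<Sum>i\<in>I. \<Sum>j\<in>I. f i * cnj (f j))"
  by (simp only: complex_norm_square cnj_sum sum_product)

text \<open>Both sides are the same fourfold sum of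
  \<open>cis ((a - b) * (\<theta> m - \<theta> m'))\<close>. Exchanging the summations trades mean
  squares over frequencies for geometric sums that decay with the distance of
  \<open>\<theta> m\<close> and \<open>\<theta> m'\<close>.\<close>

lemma sum_difference_frequencies:
  fixes \<theta> :: "nat \<Rightarrow> real" and P :: nat
  shows "(\<Sum>a<P. \<Sum>b<P. (norm (\<Sum>m\<in>M. cis ((real a - real b) * \<theta> m)))\<^sup>2)
    = (\<Sum>m\<in>M. \<Sum>m'\<in>M. (norm (\<Sum>a<P. cis (real a * (\<theta> m - \<theta> m'))))\<^sup>2)"
proof -
  have "complex_of_real (\<Sum>a<P. \<Sum>b<P. (norm (\<Sum>m\<in>M. cis ((real a - real b) * \<theta> m)))\<^sup>2)
      = (\<Sum>a<P. \<Sum>b<P. \<Sum>m\<in>M. \<Sum>m'\<in>M. cis ((real a - real b) * (\<theta> m - \<theta> m')))"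
    unfolding of_real_sum norm_power2_sum by (simp add: cis_cnj cis_mult algebra_simps)
  also have "\<dots> = (\<Sum>m\<in>M. \<Sum>m'\<in>M. \<Sum>a<P. \<Sum>b<P. cis ((real a - real b) * (\<theta> m - \<theta> m')))"
  proof -
    have rotate: "(\<Sum>a<P. \<Sum>b<P. \<Sum>m\<in>M. h a b m) = (\<Sum>m\<in>M. \<Sum>a<P. \<Sum>b<P. h a b m)"
      for h :: "nat \<Rightarrow> nat \<Rightarrow> nat \<Rightarrow> complex"
    proof -
      have "(\<Sum>a<P. \<Sum>b<P. \<Sum>m\<in>M. h a b m) = (\<Sum>a<P. \<Sum>m\<in>M. \<Sum>b<P. h a b m)"
        by (intro sum.cong refl sum.swap)
      also have "\<dots> = (\<Sum>m\<in>M. \<Sum>a<P. \<Sum>b<P. h a b m)" by (rule sum.swap)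
      finally show ?thesis .
    qed
    show ?thesis by (simp only: rotate)
  qed
  also have "\<dots> = complex_of_real (\<Sum>m\<in>M. \<Sum>m'\<in>M. (norm (\<Sum>a<P. cis (real a * (\<theta> m - \<theta> m'))))\<^sup>2)"
    unfolding of_real_sum norm_power2_sum by (simp add: cis_cnj cis_mult algebra_simps)
  finally show ?thesis by (simp only: of_real_eq_iff)
qed

text \<open>Averaging over the representations \<open>j = a - b\<close> replaces the sharp range of
  \<open>j\<close> by a Fejer-type kernel in \<open>\<theta> m - \<theta> m'\<close>. Since
  \<open>\<theta>\<close> separates distinct \<open>m\<close> by at least a multiple of
  \<open>1 / D\<close>, the kernel decays like the inverse square of \<open>m - m'\<close>. A row
  thus costs \<open>4 + 4\<close> times the square of \<open>D\<close>: once for the diagonal, once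
  for the rest.\<close>

theorem large_sieve_log_frequencies:
  fixes M :: "nat set" and D :: nat
  assumes fin: "finite M" and D: "0 < D" and M: "\<And>m. m \<in> M \<Longrightarrow> 0 < m \<and> m \<le> 2 * D"
    and close: "\<And>m m'. m \<in> M \<Longrightarrow> m' \<in> M \<Longrightarrow> 5 * m \<le> 7 * m'"
  shows "(\<Sum>j=1..D. (norm (\<Sum>m\<in>M. cis (log_freq * real j * ln (real m))))\<^sup>2) \<le> 8 * D * card M"
proof -
  define \<theta> where "\<theta> m = log_freq * ln (real m)" for m :: nat
  define S where "S x = (norm (\<Sum>m\<in>M. cis (x * \<theta> m)))\<^sup>2" for x :: real
  let ?E = "\<lambda>m m'. (norm (\<Sum>a<2 * D. cis (real a * (\<theta> m - \<theta> m'))))\<^sup>2"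
  have offdiag: "?E m m' \<le> (real D)\<^sup>2 * (1 / (real m - real m')\<^sup>2)"
    if m: "m \<in> M" "m' \<in> M" "m \<noteq> m'" for m m'
  proof -
    define \<phi> where "\<phi> = \<theta> m - \<theta> m'"
    have pos: "0 < real m" "0 < real m'" using m M by auto
    \<comment> \<open>The ratio \<open>7 / 5\<close> is below the square root of 2, so two points
      differ by at most half a turn; without this they could be close around the circle although
      \<open>m\<close> and \<open>m'\<close> are far apart.\<close>
    have ratio: "\<bar>ln (real m) - ln (real m')\<bar> \<le> ln 2 / 2"
    proof -
      have le: "ln (real x) - ln (real y) \<le> ln 2 / 2" if xy: "x \<in> M" "y \<in> M" for x y
      proof -
        have p: "0 < real x" "0 < real y" using xy M by auto
        have "5 * real x \<le> 7 * real y" using close[OF xy] by linarith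
        then have "(real x / real y)\<^sup>2 \<le> (7 / 5)\<^sup>2" using p by (intro power_mono) (auto simp: field_simps)
        also have "(7 / 5)\<^sup>2 \<le> (2 :: real)" by (simp add: power2_eq_square)
        finally have "ln ((real x / real y)\<^sup>2) \<le> ln 2"
          using p by (intro ln_mono) auto
        then show ?thesis using p by (simp add: ln_realpow ln_div)
      qed
      show ?thesis using le[OF m(1,2)] le[OF m(2,1)] by linarith
    qed
    have "\<bar>\<phi>\<bar> = log_freq * \<bar>ln (real m) - ln (real m')\<bar>"
      using log_freq_ge by (simp add: \<phi>_def \<theta>_def abs_mult flip: right_diff_distrib)
    moreover have "\<dots> \<le> log_freq * (ln 2 / 2)"
      using ratio log_freq_ge by (intro mult_left_mono) auto
    ultimately have up: "\<bar>\<phi>\<bar> \<le> pi" using log_freq_mult_ln2 by simp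
    have "8 * (\<bar>real m - real m'\<bar> / (2 * D)) \<le> log_freq * \<bar>ln (real m) - ln (real m')\<bar>"
    proof (intro mult_mono log_freq_ge abs_ln_diff_ge pos)
      show "real m \<le> real (2 * D)" "real m' \<le> real (2 * D)" using M m of_nat_le_iff by blast+
    qed (use log_freq_ge in auto)
    then have low: "4 * (\<bar>real m - real m'\<bar> / D) \<le> \<bar>\<phi>\<bar>"
      using \<open>\<bar>\<phi>\<bar> = _\<close> by simp
    have "\<bar>real m - real m'\<bar> / D \<le> \<bar>\<phi>\<bar> / 2 / 2" using low by linarith
    also have "\<dots> \<le> sin (\<bar>\<phi>\<bar> / 2)" using up by (intro half_le_sin) auto
    also have "\<dots> \<le> \<bar>sin (\<phi> / 2)\<bar>" by (cases "0 \<le> \<phi>") auto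
    finally have "norm (\<Sum>a<2 * D. cis (real a * \<phi>)) * (\<bar>real m - real m'\<bar> / D) \<le> 1"
      using norm_sum_cis_multiples_le[of \<phi> "2 * D"]
      by (meson mult_left_mono norm_ge_zero order_trans)
    then have "norm (\<Sum>a<2 * D. cis (real a * \<phi>)) \<le> D / \<bar>real m - real m'\<bar>"
      using D m by (simp add: field_simps)
    then have "(norm (\<Sum>a<2 * D. cis (real a * \<phi>)))\<^sup>2 \<le> (D / \<bar>real m - real m'\<bar>)\<^sup>2"
      by (intro power_mono) auto
    then show ?thesis by (simp add: \<phi>_def power_divide)
  qed
  have row: "(\<Sum>m'\<in>M. ?E m m') \<le> 8 * (real D)\<^sup>2" if m: "m \<in> M" for m
  proof -
    have "(\<Sum>m'\<in>M. ?E m m') = ?E m m + (\<Sum>m'\<in>M - {m}. ?E m m')"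
      using fin m by (rule sum.remove)
    also have "?E m m = 4 * (real D)\<^sup>2" by (simp add: power_mult_distrib)
    also have "(\<Sum>m'\<in>M - {m}. ?E m m') \<le> (\<Sum>m'\<in>M - {m}. (real D)\<^sup>2 * (1 / (real m - real m')\<^sup>2))"
      using m by (intro sum_mono offdiag) auto
    also have "\<dots> \<le> (real D)\<^sup>2 * 4"
      unfolding sum_distrib_left[symmetric]
      by (intro mult_left_mono sum_inverse_square_distances_le fin) auto
    finally show ?thesis by simp
  qed
  \<comment> \<open>Every \<open>j\<close> from 1 to \<open>D\<close> is a difference
    \<open>a - b\<close> with \<open>a < 2 * D\<close> for each of the \<open>D\<close> values
    \<open>b < D\<close>; by nonnegativity the double sum can then be completed to a square.\<close>
  have "real D * (\<Sum>j=1..D. S j) = (\<Sum>b<D. \<Sum>j=1..D. S j)" by simp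
  also have "\<dots> \<le> (\<Sum>b<D. \<Sum>a<2 * D. S (real a - real b))"
  proof (rule sum_mono)
    fix b assume b: "b \<in> {..<D}"
    have "(\<Sum>j=1..D. S j) = (\<Sum>a\<in>(\<lambda>j. j + b) ` {1..D}. S (real a - real b))"
      by (subst sum.reindex) (auto simp: inj_on_def)
    also have "\<dots> \<le> (\<Sum>a<2 * D. S (real a - real b))"
      using b by (intro sum_mono2) (auto simp: S_def)
    finally show "(\<Sum>j=1..D. S j) \<le> (\<Sum>a<2 * D. S (real a - real b))" .
  qed
  also have "\<dots> \<le> (\<Sum>b<2 * D. \<Sum>a<2 * D. S (real a - real b))"
    by (intro sum_mono2 sum_nonneg) (auto simp: S_def)
  also have "\<dots> = (\<Sum>a<2 * D. \<Sum>b<2 * D. S (real a - real b))" by (rule sum.swap)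
  also have "\<dots> = (\<Sum>m\<in>M. \<Sum>m'\<in>M. ?E m m')"
    unfolding S_def by (rule sum_difference_frequencies)
  also have "\<dots> \<le> (\<Sum>m\<in>M. 8 * (real D)\<^sup>2)" by (intro sum_mono row)
  also have "\<dots> = real D * (8 * D * card M)" by (simp add: power2_eq_square)
  finally have "(\<Sum>j=1..D. S j) \<le> 8 * D * card M" using D by simp
  then show ?thesis by (simp add: S_def \<theta>_def mult_ac)
qed

section \<open>Parseval on the circle and the variance of the weighted count\<close>

lemma has_integral_cis_ln:
  fixes n :: int and X :: real
  assumes X: "0 < X"
  shows "((\<lambda>x. cis (log_freq * n * ln x) / of_real x) has_integral (if n = 0 then of_real (ln 2) else 0)) {X..2 * X}"
proof (cases "n = 0")
  case True
  have "((\<lambda>x::real. 1 / x) has_integral (ln (2 * X) - ln X)) {X..2 * X}"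
    using X by (intro fundamental_theorem_of_calculus)
      (auto intro!: derivative_eq_intros simp flip: has_real_derivative_iff_has_vector_derivative)
  then have "((\<lambda>x::real. complex_of_real (1 / x)) has_integral of_real (ln 2)) {X..2 * X}"
    using X by (intro has_integral_of_real) (simp add: ln_mult)
  then show ?thesis using True by simp
next
  case False
  define c where "c = log_freq * n"
  have c: "c \<noteq> 0" using False log_freq_ge by (simp add: c_def)
  have "((\<lambda>x. cis (c * ln x) / of_real x) has_integral
      (cis (c * ln (2 * X)) / (\<i> * of_real c) - cis (c * ln X) / (\<i> * of_real c))) {X..2 * X}"
  proof (rule fundamental_theorem_of_calculus)
    fix x assume "x \<in> {X..2 * X}"
    then have x: "0 < x" using X by auto
    show "((\<lambda>x. cis (c * ln x) / (\<i> * of_real c)) has_vector_derivative cis (c * ln x) / of_real x)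
        (at x within {X..2 * X})"
      unfolding has_vector_derivative_def
      using x c by (auto intro!: derivative_eq_intros simp: field_simps scaleR_conv_of_real)
  qed (use X in auto)
  moreover have "cis (c * ln (2 * X)) = cis (c * ln X)"
  proof -
    have "c * ln (2 * X) = 2 * pi * of_int n + c * ln X"
      using X by (simp add: ln_mult distrib_left c_def log_freq_def)
    then show ?thesis
      using cis_multiple_2pi[of "of_int n"] by (metis Ints_of_int cis_mult mult_1)
  qed
  ultimately show ?thesis using False by (simp add: c_def)
qed

lemma parseval_log_frequencies:
  fixes g :: "int \<Rightarrow> complex" and X :: real
  assumes X: "0 < X" and S: "finite S"
  shows "((\<lambda>x. (norm (\<Sum>j\<in>S. g j * cis (log_freq * j * ln x)))\<^sup>2 / x) has_integral
    ln 2 * (\<Sum>j\<in>S. (norm (g j))\<^sup>2)) {X..2 * X}"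
proof -
  have "((\<lambda>x. \<Sum>j\<in>S. \<Sum>l\<in>S. g j * cnj (g l) * (cis (log_freq * of_int (j - l) * ln x) / of_real x)) has_integral
      (\<Sum>j\<in>S. \<Sum>l\<in>S. g j * cnj (g l) * (if j - l = 0 then of_real (ln 2) else 0))) {X..2 * X}"
    by (intro has_integral_sum S has_integral_mult_right has_integral_cis_ln X)
  also have "(\<Sum>j\<in>S. \<Sum>l\<in>S. g j * cnj (g l) * (if j - l = 0 then of_real (ln 2) else 0))
      = of_real (ln 2 * (\<Sum>j\<in>S. (norm (g j))\<^sup>2))"
    using S by (simp add: sum_distrib_left mult_ac complex_norm_square if_distrib del: of_real_power
        cong: if_cong)
  finally have "((\<lambda>x. Re (\<Sum>j\<in>S. \<Sum>l\<in>S. g j * cnj (g l) * (cis (log_freq * of_int (j - l) * ln x) / of_real x)))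
      has_integral Re (of_real (ln 2 * (\<Sum>j\<in>S. (norm (g j))\<^sup>2)))) {X..2 * X}"
    by (rule has_integral_Re)
  moreover have "(\<Sum>j\<in>S. \<Sum>l\<in>S. g j * cnj (g l) * (cis (log_freq * of_int (j - l) * ln x) / of_real x))
      = of_real ((norm (\<Sum>j\<in>S. g j * cis (log_freq * j * ln x)))\<^sup>2 / x)" for x
  proof -
    have "cis (log_freq * of_int (j - l) * ln x)
        = cis (log_freq * j * ln x) * cnj (cis (log_freq * l * ln x))" for j l :: int
      by (simp add: cis_cnj cis_mult algebra_simps)
    then show ?thesis
      unfolding of_real_divide norm_power2_sum by (simp add: sum_divide_distrib mult_ac)
  qed
  ultimately show ?thesis by (simp only: Re_complex_of_real)
qed

lemma chebyshev_has_integral: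
  fixes h :: "real \<Rightarrow> real"
  assumes B: "B \<in> lmeasurable" "B \<subseteq> S" and h: "(h has_integral V) S"
    and nonneg: "\<And>x. x \<in> S \<Longrightarrow> 0 \<le> h x" and large: "\<And>x. x \<in> B \<Longrightarrow> \<tau> \<le> h x"
  shows "\<tau> * measure lebesgue B \<le> V"
proof -
  have "((\<lambda>x. \<tau> * indicator B x) has_integral \<tau> * measure lebesgue B) UNIV"
    using B(1) by (intro has_integral_mult_right) (simp flip: lmeasurable_iff_has_integral)
  moreover have "((\<lambda>x. if x \<in> S then h x else 0) has_integral V) UNIV"
    using h by (simp only: has_integral_restrict_UNIV)
  ultimately show ?thesis
    by (rule has_integral_le) (use B(2) nonneg large in \<open>auto simp: indicator_def\<close>)
qed

text \<open>The coefficients may stay implicit: apart from the degree, only the value of the power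
  at 0 and its size away from 0 are used later.\<close>

lemma sum_cis_power_expansion:
  "\<exists>d :: nat \<Rightarrow> complex. \<forall>v. (\<Sum>a<J. cis (real a * v)) ^ r = (\<Sum>a\<le>r * J. d a * cis (real a * v))"
proof (intro exI allI)
  fix v :: real
  define p :: "complex poly" where "p = (\<Sum>a<J. monom 1 a) ^ r"
  have deg: "degree p \<le> r * J"
  proof -
    have "degree (\<Sum>a<J. monom (1 :: complex) a) \<le> J"
      by (intro degree_sum_le) (auto intro: order.trans[OF degree_monom_le])
    then have "degree p \<le> J * r"
      unfolding p_def by (intro order.trans[OF degree_power_le] mult_right_mono) auto
    then show ?thesis by (simp add: mult.commute)
  qed
  have pow: "cis (real a * v) = cis v ^ a" for a by (rule Complex.DeMoivre[symmetric])
  have "(\<Sum>a<J. cis (real a * v)) ^ r = poly p (cis v)"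
    by (simp add: p_def poly_sum poly_monom pow)
  also have "\<dots> = (\<Sum>a\<le>degree p. coeff p a * cis v ^ a)" by (rule poly_altdef)
  also have "\<dots> = (\<Sum>a\<le>r * J. coeff p a * cis v ^ a)"
    using deg by (intro sum.mono_neutral_left) (auto simp: coeff_eq_0)
  finally show "(\<Sum>a<J. cis (real a * v)) ^ r = (\<Sum>a\<le>r * J. coeff p a * cis (real a * v))"
    by (simp add: pow)
qed

text \<open>These correlations are the Fourier coefficients of the squared modulus of a
  trigonometric polynomial; by the inequality of arithmetic and geometric means none exceeds the
  zeroth one, its mean.\<close>

lemma norm_sum_correlation_le:
  fixes d :: "nat \<Rightarrow> complex"
  shows "norm (\<Sum>p\<in>{p \<in> {..D} \<times> {..D}. int (fst p) - int (snd p) = j}. d (fst p) * cnj (d (snd p)))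
    \<le> (\<Sum>a\<le>D. (norm (d a))\<^sup>2)"
proof -
  let ?P = "{p \<in> {..D} \<times> {..D}. int (fst p) - int (snd p) = j}"
  have finP: "finite ?P" by (rule finite_subset[of _ "{..D} \<times> {..D}"]) auto
  have proj: "(\<Sum>p\<in>?P. (norm (d (f p)))\<^sup>2) \<le> (\<Sum>a\<le>D. (norm (d a))\<^sup>2)"
    if "inj_on f ?P" "f ` ?P \<subseteq> {..D}" for f
  proof -
    have "(\<Sum>p\<in>?P. (norm (d (f p)))\<^sup>2) = (\<Sum>a\<in>f ` ?P. (norm (d a))\<^sup>2)"
      using that by (simp add: sum.reindex)
    also have "\<dots> \<le> (\<Sum>a\<le>D. (norm (d a))\<^sup>2)"
      using that by (intro sum_mono2) auto
    finally show ?thesis .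
  qed
  have "norm (\<Sum>p\<in>?P. d (fst p) * cnj (d (snd p))) \<le> (\<Sum>p\<in>?P. norm (d (fst p)) * norm (d (snd p)))"
    by (rule order.trans[OF norm_sum]) (simp add: norm_mult)
  also have "\<dots> \<le> (\<Sum>p\<in>?P. ((norm (d (fst p)))\<^sup>2 + (norm (d (snd p)))\<^sup>2) / 2)"
  proof (rule sum_mono)
    fix p
    show "norm (d (fst p)) * norm (d (snd p)) \<le> ((norm (d (fst p)))\<^sup>2 + (norm (d (snd p)))\<^sup>2) / 2"
      using sum_squares_bound[of "norm (d (fst p))" "norm (d (snd p))"] by simp
  qed
  also have "\<dots> = ((\<Sum>p\<in>?P. (norm (d (fst p)))\<^sup>2) + (\<Sum>p\<in>?P. (norm (d (snd p)))\<^sup>2)) / 2"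
    by (simp add: sum.distrib flip: sum_divide_distrib)
  also have "\<dots> \<le> ((\<Sum>a\<le>D. (norm (d a))\<^sup>2) + (\<Sum>a\<le>D. (norm (d a))\<^sup>2)) / 2"
    by (intro divide_right_mono add_mono proj) (auto simp: inj_on_def)
  finally show ?thesis by simp
qed

text \<open>The coefficient of \<open>F\<close> at frequency \<open>j\<close> is a kernel
  coefficient, at most \<open>c0\<close>, times an exponential sum over \<open>I\<close>; the shift
  \<open>\<Delta>\<close> contributes only a unimodular factor. Frequency 0 gives the subtracted
  mean, and \<open>j\<close> and \<open>- j\<close> contribute equally, whence the factor 2.\<close>

theorem log_frequency_variance:
  fixes w u :: "'i \<Rightarrow> real" and d :: "nat \<Rightarrow> complex" and X \<Delta> :: real and D :: nat
  assumes fin: "finite I" and X: "0 < X"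
  defines "c0 \<equiv> (\<Sum>a\<le>D. (norm (d a))\<^sup>2)"
  defines "F \<equiv> (\<lambda>x. \<Sum>i\<in>I. w i * (norm (\<Sum>a\<le>D. d a * cis (real a * (log_freq * (ln x + \<Delta> - u i)))))\<^sup>2)"
  shows "\<exists>V. ((\<lambda>x. (F x - c0 * (\<Sum>i\<in>I. w i))\<^sup>2 / x) has_integral V) {X..2 * X} \<and>
    V \<le> 2 * ln 2 * c0\<^sup>2 * (\<Sum>j=1..D. (norm (\<Sum>i\<in>I. of_real (w i) * cis (log_freq * real j * u i)))\<^sup>2)"
proof -
  define P where "P = {..D} \<times> {..D}"
  define c :: "int \<Rightarrow> complex" where
    "c j = (\<Sum>p\<in>{p \<in> P. int (fst p) - int (snd p) = j}. d (fst p) * cnj (d (snd p)))" for j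
  define B :: "int \<Rightarrow> complex" where
    "B j = (\<Sum>i\<in>I. of_real (w i) * cis (- (log_freq * j * u i)))" for j
  define A :: "nat \<Rightarrow> complex" where
    "A j = (\<Sum>i\<in>I. of_real (w i) * cis (log_freq * real j * u i))" for j
  define T where "T = {- int D..int D}"
  define g where "g j = c j * cis (log_freq * of_int j * \<Delta>) * B j" for j :: int
  have expand: "complex_of_real (F x) = (\<Sum>j\<in>T. g j * cis (log_freq * j * ln x))" for x
  proof -
    let ?\<phi> = "\<lambda>i. log_freq * (ln x + \<Delta> - u i)"
    have "complex_of_real (F x)
        = (\<Sum>i\<in>I. of_real (w i) * (\<Sum>p\<in>P. d (fst p) * cis (fst p * ?\<phi> i) * cnj (d (snd p) * cis (snd p * ?\<phi> i))))"
      unfolding F_def of_real_sum of_real_mult norm_power2_sum P_def sum.cartesian_product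
      by (simp add: case_prod_beta)
    also have "\<dots> = (\<Sum>i\<in>I. \<Sum>p\<in>P. d (fst p) * cnj (d (snd p)) *
        (of_real (w i) * cis (of_int (int (fst p) - int (snd p)) * ?\<phi> i)))"
    proof -
      have eq: "cis (real a * \<phi>) * cnj (cis (real b * \<phi>)) = cis (of_int (int a - int b) * \<phi>)" for a b \<phi>
        by (simp add: cis_cnj cis_mult left_diff_distrib)
      show ?thesis
        unfolding sum_distrib_left eq[symmetric] complex_cnj_mult
        by (intro sum.cong refl) (simp only: mult_ac)
    qed
    also have "\<dots> = (\<Sum>p\<in>P. d (fst p) * cnj (d (snd p)) *
        (\<Sum>i\<in>I. of_real (w i) * cis (of_int (int (fst p) - int (snd p)) * ?\<phi> i)))"
      by (subst sum.swap) (simp add: sum_distrib_left)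
    also have "\<dots> = (\<Sum>j\<in>T. \<Sum>p\<in>{p \<in> P. int (fst p) - int (snd p) = j}. d (fst p) * cnj (d (snd p)) *
        (\<Sum>i\<in>I. of_real (w i) * cis (of_int (int (fst p) - int (snd p)) * ?\<phi> i)))"
      by (rule sum.group[symmetric]) (auto simp: P_def T_def)
    also have "\<dots> = (\<Sum>j\<in>T. c j * (\<Sum>i\<in>I. of_real (w i) * cis (of_int j * ?\<phi> i)))"
      unfolding c_def sum_distrib_right by (intro sum.cong refl) auto
    also have "\<dots> = (\<Sum>j\<in>T. g j * cis (log_freq * j * ln x))"
    proof (intro sum.cong refl)
      fix j
      have "cis (of_int j * ?\<phi> i) = cis (log_freq * of_int j * \<Delta>) * cis (log_freq * j * ln x)
          * cis (- (log_freq * j * u i))" for i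
        by (simp add: cis_mult algebra_simps)
      then show "c j * (\<Sum>i\<in>I. of_real (w i) * cis (of_int j * ?\<phi> i)) = g j * cis (log_freq * j * ln x)"
        by (simp add: g_def B_def sum_distrib_left mult_ac)
    qed
    finally show ?thesis .
  qed
  have c_zero: "c 0 = of_real c0"
  proof -
    have "{p \<in> P. int (fst p) - int (snd p) = 0} = (\<lambda>a. (a, a)) ` {..D}" by (auto simp: P_def)
    then have "c 0 = (\<Sum>a\<le>D. d a * cnj (d a))"
      unfolding c_def by (simp add: sum.reindex inj_on_def)
    then show ?thesis by (simp add: c0_def complex_norm_square del: of_real_power)
  qed
  have centred: "complex_of_real (F x - c0 * (\<Sum>i\<in>I. w i))
      = (\<Sum>j\<in>T - {0}. g j * cis (log_freq * j * ln x))" for x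
  proof -
    have "0 \<in> T" by (simp add: T_def)
    then have "complex_of_real (F x) = g 0 + (\<Sum>j\<in>T - {0}. g j * cis (log_freq * j * ln x))"
      unfolding expand by (subst sum.remove[of T 0]) (auto simp: T_def)
    moreover have "g 0 = of_real (c0 * (\<Sum>i\<in>I. w i))" by (simp add: g_def c_zero B_def)
    ultimately show ?thesis by simp
  qed
  have "((\<lambda>x. (norm (\<Sum>j\<in>T - {0}. g j * cis (log_freq * j * ln x)))\<^sup>2 / x) has_integral
      ln 2 * (\<Sum>j\<in>T - {0}. (norm (g j))\<^sup>2)) {X..2 * X}"
    using X by (intro parseval_log_frequencies) (auto simp: T_def)
  then have "((\<lambda>x. (F x - c0 * (\<Sum>i\<in>I. w i))\<^sup>2 / x) has_integral
      ln 2 * (\<Sum>j\<in>T - {0}. (norm (g j))\<^sup>2)) {X..2 * X}"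
    unfolding centred[symmetric] norm_of_real by simp
  moreover have "ln 2 * (\<Sum>j\<in>T - {0}. (norm (g j))\<^sup>2) \<le> 2 * ln 2 * c0\<^sup>2 * (\<Sum>j=1..D. (norm (A j))\<^sup>2)"
  proof -
    have gB: "(norm (g j))\<^sup>2 \<le> c0\<^sup>2 * (norm (B j))\<^sup>2" for j
    proof -
      have "norm (g j) \<le> c0 * norm (B j)"
        unfolding g_def norm_mult norm_cis mult_1_right c_def P_def c0_def
        by (intro mult_right_mono norm_sum_correlation_le) auto
      then have "(norm (g j))\<^sup>2 \<le> (c0 * norm (B j))\<^sup>2" by (intro power_mono) auto
      then show ?thesis by (simp add: power_mult_distrib)
    qed
    have B_pos: "norm (B (int j)) = norm (A j)" for j
    proof -
      have "B (int j) = cnj (A j)" by (simp add: B_def A_def cis_cnj)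
      then show ?thesis by simp
    qed
    have B_neg: "norm (B (- int j)) = norm (A j)" for j
      by (simp add: B_def A_def)
    have T0: "T - {0} = int ` {1..D} \<union> (\<lambda>j. - int j) ` {1..D}"
    proof (intro equalityI subsetI)
      fix x assume x: "x \<in> T - {0}"
      show "x \<in> int ` {1..D} \<union> (\<lambda>j. - int j) ` {1..D}"
      proof (cases "0 < x")
        case True
        then have "x = int (nat x)" "nat x \<in> {1..D}" using x by (auto simp: T_def)
        then show ?thesis by blast
      next
        case False
        then have "x = - int (nat (- x))" "nat (- x) \<in> {1..D}" using x by (auto simp: T_def)
        then show ?thesis by blast
      qed
    qed (auto simp: T_def)
    have "(\<Sum>j\<in>T - {0}. (norm (g j))\<^sup>2) \<le> c0\<^sup>2 * (\<Sum>j\<in>T - {0}. (norm (B j))\<^sup>2)"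
      unfolding sum_distrib_left by (intro sum_mono gB)
    also have "(\<Sum>j\<in>T - {0}. (norm (B j))\<^sup>2)
        = (\<Sum>j\<in>int ` {1..D}. (norm (B j))\<^sup>2) + (\<Sum>j\<in>(\<lambda>j. - int j) ` {1..D}. (norm (B j))\<^sup>2)"
      unfolding T0 by (intro sum.union_disjoint) auto
    also have "\<dots> = 2 * (\<Sum>j=1..D. (norm (A j))\<^sup>2)"
      by (subst (1 2) sum.reindex) (auto simp: inj_on_def B_pos B_neg)
    finally have "ln 2 * (\<Sum>j\<in>T - {0}. (norm (g j))\<^sup>2) \<le> ln 2 * (c0\<^sup>2 * (2 * (\<Sum>j=1..D. (norm (A j))\<^sup>2)))"
      by (intro mult_left_mono) auto
    then show ?thesis by (simp add: mult_ac)
  qed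
  ultimately show ?thesis unfolding A_def by blast
qed

section \<open>The measure of the points missed by all products\<close>

lemma sum_reciprocals_ge_half:
  fixes K :: nat
  assumes "0 < K"
  shows "1 / 2 \<le> (\<Sum>k\<in>{K..<2 * K}. 1 / real k)"
proof -
  have "(\<Sum>k\<in>{K..<2 * K}. 1 / (2 * real K)) \<le> (\<Sum>k\<in>{K..<2 * K}. 1 / real k)"
    using assms by (intro sum_mono divide_left_mono) auto
  then show ?thesis using assms by simp
qed

text \<open>On \<open>B\<close> every product lies off the window, where the kernel is at most
  \<open>(1 / s) ^ (2 * r)\<close>. The hypothesis \<open>size\<close> makes this at most half the
  kernel mean \<open>c0\<close>, so \<open>F\<close> falls short of its mean by at least half on all
  of \<open>B\<close>, and Chebyshev's inequality turns the variance bound into a bound for the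
  measure.\<close>

theorem measure_missed_by_products:
  fixes M :: "nat set" and Z K D J r :: nat and X \<Delta> s :: real
  assumes Z: "1000 \<le> Z" and K: "K = Z ^ 50" and X: "0 < X" and s: "0 < s"
    and M: "finite M" "M \<noteq> {}" "\<And>m. m \<in> M \<Longrightarrow> 0 < m \<and> m \<le> 2 * D"
      "\<And>m m'. m \<in> M \<Longrightarrow> m' \<in> M \<Longrightarrow> 5 * m \<le> 7 * m'"
    and D: "0 < D" "r * J \<le> D" "log_freq * D \<le> real Z ^ 169"
    and size: "2 * (real (r * J) + 1) \<le> (real J * s) ^ (2 * r)"
    and B: "B \<in> lmeasurable" "B \<subseteq> {X..2 * X}"
    and far: "\<And>x k m. x \<in> B \<Longrightarrow> k \<in> {K..<2 * K} \<Longrightarrow> m \<in> M \<Longrightarrow>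
      s \<le> \<bar>sin (log_freq * (ln x + \<Delta> - (ln (real k) + ln (real m))) / 2)\<bar>"
  shows "measure lebesgue B \<le> 12800 * (1 / real Z) powr (1 / 4) * X * D / card M"
proof -
  define I where "I = {K..<2 * K} \<times> M"
  define w where "w i = 1 / real (fst i)" for i :: "nat \<times> nat"
  define u where "u i = ln (real (fst i)) + ln (real (snd i))" for i :: "nat \<times> nat"
  define W where "W = (\<Sum>i\<in>I. w i)"
  define \<kappa> where "\<kappa> = 5 * (1 / real Z) powr (1 / 8)"
  have K0: "0 < K" using Z by (simp add: K)
  have cardM: "0 < card M" using M by (simp add: card_gt_0_iff)
  have finI: "finite I" using M by (simp add: I_def)
  have w0: "0 \<le> w i" for i by (simp add: w_def)
  obtain d where d: "\<And>v. (\<Sum>a<J. cis (real a * v)) ^ r = (\<Sum>a\<le>r * J. d a * cis (real a * v))"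
    using sum_cis_power_expansion[of J r] by blast
  define c0 where "c0 = (\<Sum>a\<le>r * J. (norm (d a))\<^sup>2)"
  define F where
    "F x = (\<Sum>i\<in>I. w i * (norm (\<Sum>a\<le>r * J. d a * cis (real a * (log_freq * (ln x + \<Delta> - u i)))))\<^sup>2)" for x
  obtain V where V: "((\<lambda>x. (F x - c0 * W)\<^sup>2 / x) has_integral V) {X..2 * X}"
    "V \<le> 2 * ln 2 * c0\<^sup>2 * (\<Sum>j=1..r * J. (norm (\<Sum>i\<in>I. of_real (w i) * cis (log_freq * real j * u i)))\<^sup>2)"
    using log_frequency_variance[OF finI X, where w = w and d = d and D = "r * J" and \<Delta> = \<Delta> and u = u] unfolding F_def c0_def W_def by blast
  have W_eq: "W = (\<Sum>k\<in>{K..<2 * K}. 1 / real k) * card M"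
  proof -
    have "W = (\<Sum>k\<in>{K..<2 * K}. \<Sum>m\<in>M. 1 / real k)"
      unfolding W_def I_def w_def sum.cartesian_product by (simp add: case_prod_beta)
    then show ?thesis by (simp add: sum_distrib_right)
  qed
  have W: "real (card M) / 2 \<le> W" "0 < W"
  proof -
    have "1 / 2 * real (card M) \<le> W"
      unfolding W_eq by (intro mult_right_mono sum_reciprocals_ge_half K0) auto
    then show "real (card M) / 2 \<le> W" "0 < W" using cardM by auto
  qed
  \<comment> \<open>Cauchy-Schwarz at \<open>v = 0\<close>, where the kernel has its peak, bounds
    the mean from below by the peak over the number of coefficients.\<close>
  have c0: "(real J ^ r)\<^sup>2 \<le> (real (r * J) + 1) * c0"
  proof -
    have "complex_of_real (real J ^ r) = (\<Sum>a\<le>r * J. d a)" using d[of 0] by simp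
    then have "real J ^ r = norm (\<Sum>a\<le>r * J. d a)"
      by (metis abs_of_nonneg norm_of_real of_nat_0_le_iff zero_le_power)
    also have "\<dots> \<le> (\<Sum>a\<le>r * J. norm (d a))" by (rule norm_sum)
    finally have "(real J ^ r)\<^sup>2 \<le> (\<Sum>a\<le>r * J. norm (d a))\<^sup>2" by (intro power_mono) auto
    also have "\<dots> \<le> c0 * card {..r * J}"
      unfolding c0_def by (rule sum_squared_le_sum_of_squares)
    finally show ?thesis by (simp add: mult.commute add.commute)
  qed
  have Js: "0 < real J * s"
  proof (rule ccontr)
    assume "\<not> 0 < real J * s"
    then have "J = 0" using s by (auto simp: zero_less_mult_iff)
    then show False using size by (cases r) auto
  qed
  have c0_pos: "0 < c0"
  proof -
    have "0 < (real J ^ r)\<^sup>2" using Js s by (simp add: zero_less_mult_iff)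
    then have "0 < (real (r * J) + 1) * c0" using c0 by linarith
    then show ?thesis by (rule zero_less_mult_pos) (simp add: add_nonneg_pos)
  qed
  have sJ: "(1 / s) ^ (2 * r) \<le> c0 / 2"
  proof -
    have "2 * (real (r * J) + 1) \<le> (real J ^ r)\<^sup>2 * s ^ (2 * r)"
      using size by (simp add: power_mult_distrib power_mult[symmetric] mult.commute)
    also have "\<dots> \<le> ((real (r * J) + 1) * c0) * s ^ (2 * r)"
      using c0 s by (intro mult_right_mono) auto
    finally have "(real (r * J) + 1) * 2 \<le> (real (r * J) + 1) * (c0 * s ^ (2 * r))"
      by (simp add: mult_ac)
    moreover have "0 < real (r * J) + 1" by (simp add: add_nonneg_pos)
    ultimately have "2 \<le> c0 * s ^ (2 * r)" by (rule mult_le_cancel_left_pos[THEN iffD1, rotated])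
    then show ?thesis using s by (simp add: power_one_over field_simps)
  qed
  have F_small: "F x \<le> c0 / 2 * W" if x: "x \<in> B" for x
  proof -
    have "F x \<le> (\<Sum>i\<in>I. w i * (c0 / 2))"
      unfolding F_def
    proof (intro sum_mono mult_left_mono w0)
      fix i assume "i \<in> I"
      then obtain k m where i: "i = (k, m)" "k \<in> {K..<2 * K}" "m \<in> M" by (auto simp: I_def)
      let ?\<phi> = "log_freq * (ln x + \<Delta> - u i)"
      have "s \<le> \<bar>sin (?\<phi> / 2)\<bar>" using far[OF x i(2,3)] by (simp add: i u_def)
      then have "norm (\<Sum>a<J. cis (real a * ?\<phi>)) * s \<le> 1"
        using norm_sum_cis_multiples_le[of ?\<phi> J] by (meson mult_left_mono norm_ge_zero order_trans)
      then have "norm (\<Sum>a<J. cis (real a * ?\<phi>)) \<le> 1 / s" using s by (simp add: field_simps)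
      then have "norm (\<Sum>a<J. cis (real a * ?\<phi>)) ^ (2 * r) \<le> (1 / s) ^ (2 * r)"
        by (intro power_mono) auto
      then show "(norm (\<Sum>a\<le>r * J. d a * cis (real a * ?\<phi>)))\<^sup>2 \<le> c0 / 2"
        unfolding d[symmetric] using sJ by (simp add: norm_power power_mult[symmetric] mult.commute)
    qed
    then show ?thesis by (simp add: W_def sum_distrib_left sum_divide_distrib mult_ac)
  qed
  \<comment> \<open>The square of the deviation \<open>c0 * W / 2\<close> times the least value
    \<open>1 / (2 * X)\<close> of the weight \<open>1 / x\<close>.\<close>
  define \<tau> where "\<tau> = (c0 * W / 2)\<^sup>2 / (2 * X)"
  have "\<tau> * measure lebesgue B \<le> V"
  proof (rule chebyshev_has_integral[OF B V(1)])
    fix x assume "x \<in> {X..2 * X}"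
    then show "0 \<le> (F x - c0 * W)\<^sup>2 / x" using X by auto
  next
    fix x assume x: "x \<in> B"
    have "F x - c0 * W \<le> - (c0 * W / 2)" using F_small[OF x] by (simp add: field_simps)
    then have "c0 * W / 2 \<le> \<bar>F x - c0 * W\<bar>" by linarith
    then have "(c0 * W / 2)\<^sup>2 \<le> (F x - c0 * W)\<^sup>2"
      using c0_pos W by (subst abs_le_square_iff[symmetric]) (auto simp: abs_of_pos)
    then show "\<tau> \<le> (F x - c0 * W)\<^sup>2 / x"
      unfolding \<tau>_def using x B X by (intro frac_le) auto
  qed
  also have "V \<le> 2 * ln 2 * c0\<^sup>2 * (\<kappa>\<^sup>2 * (8 * D * card M))"
  proof -
    \<comment> \<open>Here the product structure enters: \<open>u\<close> is additive in
      \<open>(k, m)\<close> and the weight depends on \<open>k\<close> alone, so the sum splits into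
      one factor bounded uniformly in \<open>j\<close> and one left to the large sieve.\<close>
    have factor: "(\<Sum>i\<in>I. of_real (w i) * cis (log_freq * real j * u i))
        = (\<Sum>k\<in>{K..<2 * K}. of_real (1 / real k) * cis (log_freq * real j * ln (real k)))
          * (\<Sum>m\<in>M. cis (log_freq * real j * ln (real m)))" for j
      unfolding I_def w_def u_def sum_product
      by (simp add: sum.cartesian_product case_prod_beta distrib_left flip: cis_mult)
    have "(\<Sum>j=1..r * J. (norm (\<Sum>i\<in>I. of_real (w i) * cis (log_freq * real j * u i)))\<^sup>2)
        \<le> (\<Sum>j=1..r * J. \<kappa>\<^sup>2 * (norm (\<Sum>m\<in>M. cis (log_freq * real j * ln (real m))))\<^sup>2)"
      unfolding factor norm_mult power_mult_distrib
    proof (intro sum_mono mult_right_mono power_mono)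
      fix j assume j: "j \<in> {1..r * J}"
      have "log_freq * real j \<le> log_freq * real D"
        using j D log_freq_ge by (intro mult_left_mono) auto
      then show "norm (\<Sum>k\<in>{K..<2 * K}. of_real (1 / real k) * cis (log_freq * real j * ln (real k))) \<le> \<kappa>"
        unfolding \<kappa>_def using j D Z
        by (intro reciprocal_log_sum_bound[OF Z K]) (auto simp: log_freq_def)
    qed auto
    also have "\<dots> \<le> (\<Sum>j=1..D. \<kappa>\<^sup>2 * (norm (\<Sum>m\<in>M. cis (log_freq * real j * ln (real m))))\<^sup>2)"
      using D by (intro sum_mono2) auto
    also have "\<dots> \<le> \<kappa>\<^sup>2 * (8 * D * card M)"
      unfolding sum_distrib_left[symmetric]
      using M D by (intro mult_left_mono large_sieve_log_frequencies) auto
    finally show ?thesis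
      by (intro order.trans[OF V(2)] mult_left_mono) auto
  qed
  also have "\<dots> \<le> 2 * 1 * c0\<^sup>2 * (\<kappa>\<^sup>2 * (8 * D * card M))"
    using ln2_le_25_over_36 by (intro mult_right_mono mult_left_mono) auto
  finally have "c0\<^sup>2 * (W\<^sup>2 * measure lebesgue B) \<le> c0\<^sup>2 * (128 * \<kappa>\<^sup>2 * X * D * card M)"
    unfolding \<tau>_def using X by (simp add: power_mult_distrib power_divide field_simps)
  then have "W\<^sup>2 * measure lebesgue B \<le> 128 * \<kappa>\<^sup>2 * X * D * card M"
    using c0_pos by simp
  moreover have "(real (card M) / 2)\<^sup>2 * measure lebesgue B \<le> W\<^sup>2 * measure lebesgue B"
    using W by (intro mult_right_mono power_mono) auto
  ultimately have "(real (card M) / 2)\<^sup>2 * measure lebesgue B \<le> 128 * \<kappa>\<^sup>2 * X * D * card M"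
    by linarith
  then have "real (card M) * measure lebesgue B \<le> 512 * \<kappa>\<^sup>2 * X * D"
    using cardM by (simp add: power2_eq_square field_simps)
  also have "\<kappa>\<^sup>2 = 25 * (1 / real Z) powr (1 / 4)"
    by (simp add: \<kappa>_def power_mult_distrib power2_eq_square flip: powr_add)
  finally show ?thesis using cardM by (simp add: field_simps)
qed

section \<open>The exceptional set\<close>

lemma finite_nat_Icc: "finite {n :: nat. a \<le> real n \<and> real n \<le> b}"
  by (rule finite_subset[of _ "{..nat \<lfloor>b\<rfloor>}"]) (auto simp: le_nat_floor)

lemma card_nat_Icc_ge:
  fixes a s :: real
  assumes "0 \<le> a" "2 \<le> s * a"
  shows "s * a / 2 \<le> card {n :: nat. a \<le> n \<and> n \<le> (1 + s) * a}"
proof -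
  have "{nat \<lceil>a\<rceil>..nat \<lfloor>(1 + s) * a\<rfloor>} \<subseteq> {n :: nat. a \<le> n \<and> n \<le> (1 + s) * a}"
    using assms by (auto simp: nat_le_iff le_nat_iff ceiling_le_iff le_floor_iff algebra_simps)
  then have "card {nat \<lceil>a\<rceil>..nat \<lfloor>(1 + s) * a\<rfloor>} \<le> card {n :: nat. a \<le> n \<and> n \<le> (1 + s) * a}"
    by (intro card_mono finite_nat_Icc)
  moreover have "s * a - 1 \<le> card {nat \<lceil>a\<rceil>..nat \<lfloor>(1 + s) * a\<rfloor>}"
  proof -
    have "\<lceil>a\<rceil> < a + 1" "(1 + s) * a < \<lfloor>(1 + s) * a\<rfloor> + 1" by linarith+
    moreover have "0 \<le> \<lceil>a\<rceil>" "0 \<le> \<lfloor>(1 + s) * a\<rfloor>"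
      using assms by (auto simp: algebra_simps)
    ultimately show ?thesis
      by (simp add: algebra_simps of_nat_diff)
  qed
  ultimately show ?thesis using assms by linarith
qed

lemma half_le_ln_one_plus:
  fixes h :: real
  assumes "0 \<le> h" "h \<le> 1"
  shows "h / 2 \<le> ln (1 + h)"
proof -
  have "ln (1 / (1 + h)) \<le> 1 / (1 + h) - 1"
    using assms by (intro ln_le_minus_one) auto
  then have "h / (1 + h) \<le> ln (1 + h)"
    using assms by (simp add: ln_div field_simps)
  moreover have "h / 2 \<le> h / (1 + h)"
    using assms by (intro divide_left_mono) auto
  ultimately show ?thesis by linarith
qed

text \<open>Half the phase stays at distance at least \<open>log_freq * \<Delta> / 2\<close> from
  both 0 and \<open>pi\<close>; the slope 1/2 of the sine bound and \<open>log_freq \<ge> 8\<close>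
  give the constant 2.\<close>

lemma abs_sin_log_freq_ge:
  fixes v \<Delta> :: real
  assumes "0 \<le> \<Delta>" "\<Delta> \<le> \<bar>v\<bar>" "\<bar>v\<bar> \<le> ln 2 - \<Delta>"
  shows "2 * \<Delta> \<le> \<bar>sin (log_freq * v / 2)\<bar>"
proof -
  define x where "x = log_freq * \<bar>v\<bar> / 2"
  have \<omega>: "8 * \<Delta> \<le> log_freq * \<Delta>" using assms log_freq_ge by (intro mult_right_mono) auto
  have low: "log_freq * \<Delta> / 2 \<le> x"
    unfolding x_def using assms log_freq_ge by (intro divide_right_mono mult_left_mono) auto
  have "log_freq * \<bar>v\<bar> \<le> log_freq * (ln 2 - \<Delta>)"
    using assms log_freq_ge by (intro mult_left_mono) auto
  then have up: "x \<le> pi - log_freq * \<Delta> / 2"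
    using log_freq_mult_ln2 by (simp add: x_def right_diff_distrib)
  have "2 * \<Delta> \<le> sin x"
  proof (cases "x \<le> pi / 2")
    case True
    then show ?thesis using half_le_sin[of x] low \<omega> assms by linarith
  next
    case False
    then show ?thesis using half_le_sin[of "pi - x"] up \<omega> assms by simp
  qed
  also have "sin x \<le> \<bar>sin (log_freq * v / 2)\<bar>"
    unfolding x_def by (cases "0 \<le> v") auto
  finally show ?thesis .
qed

text \<open>\<open>K\<close> is the 50th power of a rounded number, and this shows that the rounding
  costs at most a factor 2 in \<open>K\<close>.\<close>

lemma power_ceiling_le:
  fixes z :: real
  assumes "1000 \<le> z"
  shows "real (nat \<lceil>z\<rceil>) ^ 50 \<le> 2 * z ^ 50"
proof -
  have "real (nat \<lceil>z\<rceil>) \<le> z * (1 + 1 / z)" using assms by (simp add: algebra_simps) linarith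
  also have "\<dots> \<le> z * exp (1 / z)" using assms by (intro mult_left_mono) auto
  finally have "real (nat \<lceil>z\<rceil>) ^ 50 \<le> (z * exp (1 / z)) ^ 50" by (intro power_mono) auto
  also have "\<dots> = z ^ 50 * exp (50 / z)"
    by (simp add: power_mult_distrib flip: exp_of_nat_mult)
  also have "exp (50 / z) \<le> exp (1 / 2)" using assms by (simp add: field_simps)
  also have "exp (1 / 2) \<le> (2 :: real)" by (rule exp_half_le2)
  finally show ?thesis using assms by (simp add: mult.commute mult_left_mono)
qed

text \<open>The width parameter \<open>s\<close> confines \<open>m\<close> to \<open>[X / K, (1 + s)\<^sup>3 X / K]\<close>. On the circle \<open>k m\<close> and \<open>x\<close> are
  only compared up to powers of \<open>2\<close>; discarding \<open>x\<close> within a factor \<open>(1 + s)\<^sup>3\<close> of the end points \<open>X\<close> and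
  \<open>2X\<close> excludes the spurious coincidences \<open>k m \<approx> 2x\<close> and \<open>k m \<approx> x / 2\<close>, at the cost of the term
  \<open>12 s X\<close>.\<close>

lemma exceptional_set_measure_le:
  fixes \<epsilon> s X C :: real and r :: nat
  assumes \<epsilon>: "0 < \<epsilon>" and s: "0 < s" "s \<le> 1 / 10" and r: "1 \<le> r" "1 \<le> r * \<epsilon>"
    and C: "0 < C" "\<And>n :: nat. 0 < n \<Longrightarrow> card {d. d dvd n} \<le> C * real n powr (1 / 4000)"
    and X: "1 \<le> X" "1000 \<le> X powr (13 / 2750)" "4 \<le> s * X powr (16 / 165)"
      "8 * r \<le> X powr (42 / 55)" "X powr (\<epsilon> - 42 / 55) \<le> s" "4 * (16 * r) ^ (2 * r) \<le> X"
  shows "measure lebesgue (exceptional_set \<epsilon> X)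
    \<le> 12 * s * X + 102400 * C\<^sup>2 / s ^ 3 * X powr (1 / 2000 - 13 / 11000) * X"
proof -
  \<comment> \<open>\<open>2750 = 50 * 55\<close>, so that \<open>K = Z ^ 50\<close> is
    \<open>X powr (13 / 55)\<close> up to a factor 2.\<close>
  define Z where "Z = nat \<lceil>X powr (13 / 2750)\<rceil>"
  define K where "K = Z ^ 50"
  define y where "y = X powr (1 / 3)"
  define N where "N = X / K"
  define \<sigma> where "\<sigma> = (1 + s) ^ 3"
  \<comment> \<open>\<open>L\<close> holds the cofactors \<open>l\<close> of
    \<open>n1 = k * l\<close>, and \<open>R\<close> serves for both \<open>n2\<close> and
    \<open>n3\<close>. The scale \<open>y / K\<close> is about \<open>X powr (16 / 165)\<close>,
    because \<open>1 / 3 - 13 / 55 = 16 / 165\<close>.\<close>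
  define L where "L = {n :: nat. y / K \<le> n \<and> n \<le> (1 + s) * (y / K)}"
  define R where "R = {n :: nat. y \<le> n \<and> n \<le> (1 + s) * y}"
  define M where "M = (\<lambda>(a, b, c). a * b * c) ` (L \<times> R \<times> R)"
  define D where "D = nat \<lfloor>N\<rfloor>"
  define J where "J = nat \<lfloor>N / r\<rfloor>"
  define H where "H = X powr (13 / 55 + \<epsilon>)"
  \<comment> \<open>On the logarithmic scale \<open>[x, x + H]\<close> has length at least
    \<open>H / (4 * X) = 2 * \<Delta>\<close> for \<open>x \<le> 2 * X\<close>; adding
    \<open>\<Delta>\<close> to \<open>ln x\<close> centres the window.\<close>
  define \<Delta> where "\<Delta> = H / (8 * X)"
  define B where "B = exceptional_set \<epsilon> X \<inter> {\<sigma> * X..2 * X / \<sigma>}"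

  have Z: "1000 \<le> Z" "X powr (13 / 2750) \<le> real Z"
    using X(2) unfolding Z_def by linarith+
  have K_ge: "1 \<le> real K" "0 < K" using Z by (auto simp: K_def one_le_power)
  have K_le: "real K \<le> 2 * X powr (13 / 55)"
  proof -
    have "real K \<le> 2 * (X powr (13 / 2750)) ^ 50"
      unfolding K_def Z_def of_nat_power by (rule power_ceiling_le[OF X(2)])
    also have "(X powr (13 / 2750)) ^ 50 = X powr (13 / 55)"
      using X by (simp add: powr_powr flip: powr_realpow)
    finally show ?thesis .
  qed
  \<comment> \<open>\<open>2750 / 13\<close> lies just below 212. Dividing by \<open>K\<close>
    leaves \<open>N \<le> Z ^ 162\<close>, within the frequency range \<open>Z ^ 169\<close> even
    after multiplication by \<open>log_freq\<close>.\<close>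
  have X_le: "X \<le> real Z ^ 212"
  proof -
    have "X = (X powr (13 / 2750)) powr (2750 / 13)" using X by (simp add: powr_powr)
    also have "\<dots> \<le> real Z powr (2750 / 13)" using Z by (intro powr_mono2) auto
    also have "\<dots> \<le> real Z powr 212" using Z by (intro powr_mono) auto
    finally show ?thesis using Z by simp
  qed
  have y: "1 \<le> y" "y ^ 3 = X"
    using X by (auto simp: y_def ge_one_powr_ge_zero powr_powr simp flip: powr_realpow)
  have \<sigma>: "1 + s \<le> \<sigma>" "\<sigma> \<le> 1 + 4 * s" "0 < \<sigma>" "\<sigma> \<le> 7 / 5"
  proof -
    have eq: "\<sigma> = 1 + 3 * s + 3 * (s * s) + s * (s * s)"
      by (simp add: \<sigma>_def power3_eq_cube algebra_simps)
    have ss: "0 \<le> s * s" "s * s \<le> 1 / 10 * s" using s by (auto intro: mult_right_mono)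
    moreover have "s * (s * s) \<le> 1 * (s * s)" "0 \<le> s * (s * s)" using s by (auto intro: mult_right_mono)
    ultimately show "1 + s \<le> \<sigma>" "\<sigma> \<le> 1 + 4 * s" using s unfolding eq by linarith+
    then show "0 < \<sigma>" "\<sigma> \<le> 7 / 5" using s by linarith+
  qed
  have N_ge: "4 * r \<le> N" "4 \<le> N"
  proof -
    have "X powr (42 / 55) * X powr (13 / 55) = X" using X by (simp flip: powr_add)
    then have "X powr (42 / 55) / 2 = X / (2 * X powr (13 / 55))" using X by (simp add: field_simps)
    also have "\<dots> \<le> N" unfolding N_def using X K_ge K_le by (intro divide_left_mono) auto
    finally show "4 * r \<le> N" using X(4) by linarith
    then show "4 \<le> N" using r by linarith
  qed
  have N_le: "N \<le> X" "N \<le> real Z ^ 162"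
  proof -
    show "N \<le> X" unfolding N_def using X K_ge by (simp add: field_simps)
    have "real Z ^ 212 = real Z ^ 162 * real K" by (simp add: K_def flip: power_add)
    then show "N \<le> real Z ^ 162" unfolding N_def using X_le K_ge by (simp add: field_simps)
  qed
  have D: "real D \<le> N" "N < D + 1" using N_ge unfolding D_def by linarith+
  have J: "r * J \<le> N" "N / (2 * r) \<le> J"
  proof -
    have "0 \<le> N / r" using N_ge by simp
    then have 1: "J \<le> N / r" "N / r < real J + 1" unfolding J_def by linarith+
    then show "r * J \<le> N" using r by (simp add: field_simps)
    have "4 \<le> N / r" using N_ge r by (simp add: field_simps)
    then have "N / r \<le> 2 * real J" using 1 by linarith
    then show "N / (2 * r) \<le> J" using r by (simp add: field_simps)
  qed
  have H_eq: "H / X = X powr (\<epsilon> - 42 / 55)"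
  proof -
    have "13 / 55 + \<epsilon> = (\<epsilon> - 42 / 55) + 1" by simp
    then have "H = X powr (\<epsilon> - 42 / 55) * X"
      unfolding H_def using X by (simp only: powr_add powr_one)
    then show ?thesis using X by simp
  qed
  have H0: "0 < H" "H / X \<le> s" using X H_eq by (auto simp: H_def)
  have \<Delta>: "0 < \<Delta>" "2 * \<Delta> \<le> ln \<sigma>" "2 * \<Delta> = H / X / 4"
  proof -
    show "0 < \<Delta>" "2 * \<Delta> = H / X / 4" using H0 X by (auto simp: \<Delta>_def)
    have "s / 2 \<le> ln (1 + s)" using s by (intro half_le_ln_one_plus) auto
    also have "\<dots> \<le> ln \<sigma>" using \<sigma> s by (intro ln_mono) auto
    finally have "s / 2 \<le> ln \<sigma>" .
    moreover have "H / X / 4 \<le> s / 4" using H0 by (intro divide_right_mono) auto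
    ultimately show "2 * \<Delta> \<le> ln \<sigma>" unfolding \<open>2 * \<Delta> = H / X / 4\<close> using s by linarith
  qed

  have L_big: "2 \<le> s * (y / K)"
  proof -
    have "X powr (16 / 165) * X powr (13 / 55) = y" using X by (simp add: y_def flip: powr_add)
    then have "X powr (16 / 165) / 2 = y / (2 * X powr (13 / 55))" using X by (simp add: field_simps)
    also have "\<dots> \<le> y / K" using X K_ge K_le y by (intro divide_left_mono) auto
    finally have "s * (X powr (16 / 165) / 2) \<le> s * (y / K)" using s by (intro mult_left_mono) auto
    then show ?thesis using X(3) by linarith
  qed
  have yK: "y / K \<le> y" using K_ge y by (simp add: field_simps)
  have R_big: "2 \<le> s * y"
    using L_big mult_left_mono[OF yK, of s] s by linarith
  have fin: "finite L" "finite R"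
    unfolding L_def R_def by (rule finite_nat_Icc)+
  have yK0: "0 < y / K" using y K_ge by simp
  have nonzero: "0 \<notin> L" "0 \<notin> R" using yK0 y by (auto simp: L_def R_def)
  have M_bounds: "N \<le> m \<and> m \<le> \<sigma> * N" if m: "m \<in> M" for m
  proof -
    obtain a b c where abc: "m = a * b * c" "a \<in> L" "b \<in> R" "c \<in> R"
      using m by (auto simp: M_def)
    have "(y / K) * y * y \<le> real a * real b * real c"
      using abc y yK0 by (intro mult_mono) (auto simp: L_def R_def)
    moreover have "real a * real b * real c \<le> ((1 + s) * (y / K)) * ((1 + s) * y) * ((1 + s) * y)"
      using abc y yK0 s by (intro mult_mono) (auto simp: L_def R_def)
    moreover have "(y / K) * y * y = N" "((1 + s) * (y / K)) * ((1 + s) * y) * ((1 + s) * y) = \<sigma> * N"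
      by (simp_all add: N_def \<sigma>_def power3_eq_cube flip: y(2))
    ultimately show ?thesis by (simp add: abc)
  qed
  \<comment> \<open>All products are at most \<open>X\<close>, so each arises from at most
    \<open>t\<close> squared triples; this costs \<open>X powr (1 / 2000)\<close> against the count
    of triples, which is at least \<open>s ^ 3 * N / 8\<close>.\<close>
  have card_M: "s ^ 3 * N / (8 * C\<^sup>2 * X powr (1 / 2000)) \<le> card M"
  proof -
    define t where "t = nat \<lfloor>C * X powr (1 / 4000)\<rfloor>"
    have "card L * card R * card R \<le> t\<^sup>2 * card M"
      unfolding M_def
    proof (rule card_triple_products_ge)
      fix a b c assume abc: "a \<in> L" "b \<in> R" "c \<in> R"
      then have "(a, b, c) \<in> L \<times> R \<times> R" by simp
      from imageI[OF this, of "\<lambda>(a, b, c). a * b * c"]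
      have m: "a * b * c \<in> M" "0 < a * b * c"
        using nonzero abc by (auto simp: M_def intro!: Nat.gr0I)
      have "real (a * b * c) \<le> \<sigma> * N" using M_bounds[OF m(1)] by simp
      also have "\<dots> \<le> 2 * N" using \<sigma> N_ge by (intro mult_right_mono) auto
      also have "\<dots> \<le> X"
      proof -
        have "real Z ^ 1 \<le> real K"
          unfolding K_def of_nat_power using Z by (intro power_increasing) auto
        moreover have "2 \<le> real Z ^ 1" using Z by simp
        ultimately have "2 \<le> real K" by linarith
        then show ?thesis unfolding N_def using X by (simp add: field_simps)
      qed
      finally have "real (a * b * c) powr (1 / 4000) \<le> X powr (1 / 4000)" by (intro powr_mono2) auto
      then have "card {d. d dvd a * b * c} \<le> C * X powr (1 / 4000)"
        using C(2)[OF m(2)] C(1) by (meson mult_left_mono less_imp_le order_trans)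
      then show "card {d. d dvd a * b * c} \<le> t" unfolding t_def by (simp add: le_nat_floor)
    qed (use fin nonzero in auto)
    then have "real (card L) * real (card R) * real (card R) \<le> (real t)\<^sup>2 * card M"
      by (metis of_nat_le_iff of_nat_mult of_nat_power)
    moreover have "(s * (y / K) / 2) * (s * y / 2) * (s * y / 2)
        \<le> real (card L) * real (card R) * real (card R)"
      using card_nat_Icc_ge[of "y / K" s] card_nat_Icc_ge[of y s] yK0 y L_big R_big s
      unfolding L_def R_def by (intro mult_mono) auto
    moreover have "(s * (y / K) / 2) * (s * y / 2) * (s * y / 2) = s ^ 3 * N / 8"
      by (simp add: N_def power3_eq_cube mult_ac flip: y(2))
    moreover have "(real t)\<^sup>2 * card M \<le> (C\<^sup>2 * X powr (1 / 2000)) * card M"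
    proof -
      have "real t \<le> C * X powr (1 / 4000)" unfolding t_def using C by simp
      then have "(real t)\<^sup>2 \<le> (C * X powr (1 / 4000))\<^sup>2" by (intro power_mono) auto
      also have "\<dots> = C\<^sup>2 * X powr (1 / 2000)"
        by (simp add: power_mult_distrib power2_eq_square flip: powr_add)
      finally show ?thesis by (intro mult_right_mono) auto
    qed
    ultimately have "s ^ 3 * N / 8 \<le> (C\<^sup>2 * X powr (1 / 2000)) * card M" by linarith
    then show ?thesis using C X by (simp add: field_simps)
  qed
  have M_pos: "0 < s ^ 3 * N / (8 * C\<^sup>2 * X powr (1 / 2000))" using s N_ge C X by auto

  have B_meas: "B \<in> lmeasurable"
  proof -
    have "B \<in> sets lebesgue"
      unfolding B_def using exceptional_set_borel[of \<epsilon> X] by (intro sets.Int) auto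
    then show ?thesis
      by (rule fmeasurableI2[of "{X..2 * X}", rotated 2]) (auto simp: B_def exceptional_set_def)
  qed
  have far: "2 * \<Delta> \<le> \<bar>sin (log_freq * (ln x + \<Delta> - (ln (real k) + ln (real m))) / 2)\<bar>"
    if x: "x \<in> B" and k: "k \<in> {K..<2 * K}" and m: "m \<in> M" for x k m
  proof -
    obtain l b c where lbc: "m = l * b * c" "l \<in> L" "b \<in> R" "c \<in> R"
      using m by (auto simp: M_def)
    have xb: "\<sigma> * X \<le> x" "x \<le> 2 * X / \<sigma>" "x \<in> exceptional_set \<epsilon> X" using x by (auto simp: B_def)
    have xX: "X \<le> x" "x \<le> 2 * X" using xb by (auto simp: exceptional_set_def)
    \<comment> \<open>The cut at \<open>\<sigma> * X\<close> has a second use: since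
      \<open>\<sigma> * X\<close> is the cube of \<open>(1 + s) * y\<close>, it keeps
      \<open>k * l\<close>, which may be as large as \<open>2 * (1 + s) * y\<close>, below twice the
      cube root of \<open>x\<close>.\<close>
    have root: "(1 + s) * y \<le> x powr (1 / 3)" "x powr (1 / 3) / 2 \<le> y"
    proof -
      have "((1 + s) * y) powr 3 = \<sigma> * X"
        using s y by (simp add: \<sigma>_def power_mult_distrib)
      then have "(1 + s) * y = (\<sigma> * X) powr (1 / 3)"
        using s y by (metis (no_types, opaque_lifting) mult_nonneg_nonneg add_nonneg_nonneg
            divide_self_if less_eq_real_def order_trans powr_one powr_powr times_divide_eq_right
            mult.right_neutral zero_le_one zero_neq_numeral)
      also have "\<dots> \<le> x powr (1 / 3)" using xb \<sigma> X by (intro powr_mono2) auto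
      finally show "(1 + s) * y \<le> x powr (1 / 3)" .
      have "x powr (1 / 3) \<le> (8 * X) powr (1 / 3)" using xX X by (intro powr_mono2) auto
      also have "\<dots> = 2 * y"
      proof -
        have "(8 :: real) powr (1 / 3) = (2 powr 3) powr (1 / 3)" by simp
        also have "\<dots> = 2" by (simp only: powr_powr) simp
        finally show ?thesis using X by (simp add: powr_mult y_def)
      qed
      finally show "x powr (1 / 3) / 2 \<le> y" by simp
    qed
    have kK: "real K \<le> k" "real k \<le> 2 * real K" using k by auto
    have n1: "y \<le> real (k * l)" "real (k * l) \<le> 2 * ((1 + s) * y)"
    proof -
      have "real K * (y / K) \<le> real k * real l"
        using kK lbc yK0 by (intro mult_mono) (auto simp: L_def)
      then show "y \<le> real (k * l)" using K_ge by simp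
      have "real k * real l \<le> (2 * real K) * ((1 + s) * (y / K))"
        using kK lbc by (intro mult_mono) (auto simp: L_def)
      then show "real (k * l) \<le> 2 * ((1 + s) * y)" using K_ge by simp
    qed
    have R_in: "0 < n \<and> real n \<in> {x powr (1 / 3) / 2 .. 2 * x powr (1 / 3)}" if "n \<in> R" for n
    proof -
      have "y \<le> n" "n \<le> (1 + s) * y" using that by (auto simp: R_def)
      moreover have "0 \<le> x powr (1 / 3)" by simp
      ultimately show ?thesis using root y nonzero that by (auto intro!: Nat.gr0I)
    qed
    have "0 < k * l" using nonzero lbc kK K_ge by (auto intro!: Nat.gr0I)
    moreover have "real (k * l) \<in> {x powr (1 / 3) / 2 .. 2 * x powr (1 / 3)}"
      using n1 root by auto
    ultimately have "k * l * b * c \<in> balanced_triple_products x"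
      unfolding balanced_triple_products_def using R_in[OF lbc(3)] R_in[OF lbc(4)] by blast
    then have miss: "real (k * m) \<notin> {x .. x + x powr (13 / 55 + \<epsilon>)}"
      using xb(3) unfolding exceptional_set_def lbc(1) by (auto simp: mult_ac)
    have m0: "0 < real m" using M_bounds[OF m] N_ge by linarith
    have k0: "0 < real k" using kK K_ge by linarith
    have km: "X \<le> real (k * m)" "real (k * m) \<le> 2 * \<sigma> * X"
    proof -
      have NK: "real K * N = X" unfolding N_def using K_ge by simp
      have "real K * N \<le> real k * real m"
        using kK M_bounds[OF m] N_ge by (intro mult_mono) auto
      then show "X \<le> real (k * m)" using NK by simp
      have "real k * real m \<le> (2 * real K) * (\<sigma> * N)"
        using kK M_bounds[OF m] N_ge by (intro mult_mono) auto
      also have "\<dots> = 2 * \<sigma> * (real K * N)" by simp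
      finally show "real (k * m) \<le> 2 * \<sigma> * X" unfolding NK by simp
    qed
    have ln_km: "ln (real k) + ln (real m) = ln (real (k * m))"
      using m0 k0 by (simp add: ln_mult)
    let ?v = "ln x + \<Delta> - ln (real (k * m))"
    \<comment> \<open>In either case missing the interval gives the lower bound
      \<open>\<Delta>\<close>, while the room \<open>ln \<sigma> \<ge> 2 * \<Delta>\<close> left by
      trimming the end points gives the upper bound \<open>ln 2 - \<Delta>\<close>.\<close>
    have "\<Delta> \<le> \<bar>?v\<bar> \<and> \<bar>?v\<bar> \<le> ln 2 - \<Delta>"
    proof (cases "real (k * m) < x")
      case True
      have "ln (real (k * m)) \<le> ln x" using True km X by (intro ln_mono) auto
      then have "\<Delta> \<le> ?v" by simp
      moreover have "ln x \<le> ln (2 * X / \<sigma>)" using xb xX X by (intro ln_mono) auto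
      then have "ln x \<le> ln 2 + ln X - ln \<sigma>" using X \<sigma> by (simp add: ln_mult ln_div)
      moreover have "ln X \<le> ln (real (k * m))" using km X by (intro ln_mono) auto
      ultimately show ?thesis using \<Delta> by auto
    next
      case False
      have "H \<le> x powr (13 / 55 + \<epsilon>)"
        unfolding H_def using xX X \<epsilon> by (intro powr_mono2) auto
      then have big: "x + H < real (k * m)" using miss False by auto
      have "2 * \<Delta> = (H / (2 * X)) / 2" using \<Delta>(3) by simp
      also have "\<dots> \<le> ln (1 + H / (2 * X))"
      proof (rule half_le_ln_one_plus)
        have "H / X / 2 \<le> s / 2" using H0 by (intro divide_right_mono) auto
        then show "H / (2 * X) \<le> 1" using s by simp
      qed (use H0 X in auto)
      also have "\<dots> \<le> ln (1 + H / x)"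
        using xX X H0 by (intro ln_mono add_left_mono divide_left_mono) (auto intro: add_pos_nonneg)
      also have "1 + H / x = (x + H) / x" using xX X by (simp add: field_simps)
      also have "ln ((x + H) / x) = ln (x + H) - ln x" using xX X H0 by (simp add: ln_div)
      finally have "2 * \<Delta> \<le> ln (x + H) - ln x" .
      moreover have "ln (x + H) \<le> ln (real (k * m))" using big xX X H0 by (intro ln_mono) auto
      ultimately have "?v \<le> - \<Delta>" by linarith
      moreover have "ln (real (k * m)) \<le> ln (2 * \<sigma> * X)" using km X by (intro ln_mono) auto
      then have "ln (real (k * m)) \<le> ln 2 + ln \<sigma> + ln X" using X \<sigma> by (simp add: ln_mult)
      moreover have "ln (\<sigma> * X) \<le> ln x" using xb \<sigma> X by (intro ln_mono) auto
      then have "ln \<sigma> + ln X \<le> ln x" using X \<sigma> by (simp add: ln_mult)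
      ultimately show ?thesis using \<Delta> by auto
    qed
    then show ?thesis unfolding ln_km using \<Delta> by (intro abs_sin_log_freq_ge) auto
  qed
  \<comment> \<open>\<open>J * 2 * \<Delta>\<close> is at least
    \<open>X powr \<epsilon> / (16 * r)\<close>. As \<open>r * \<epsilon> \<ge> 1\<close>, its power
    \<open>2 * r\<close> is at least the square of \<open>X\<close> over a constant, hence at least
    \<open>4 * X\<close>, while the left side is at most \<open>4 * X\<close>.\<close>
  have size: "2 * (real (r * J) + 1) \<le> (real J * (2 * \<Delta>)) ^ (2 * r)"
  proof -
    have "X powr \<epsilon> / (16 * r) \<le> X powr (13 / 55 + \<epsilon>) / (8 * r * K)"
    proof -
      have "X powr \<epsilon> / (16 * r) = X powr (13 / 55 + \<epsilon>) / (8 * r * (2 * X powr (13 / 55)))"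
        using X r by (simp add: powr_add)
      also have "\<dots> \<le> X powr (13 / 55 + \<epsilon>) / (8 * r * K)"
        using K_le K_ge r X by (intro divide_left_mono mult_left_mono) auto
      finally show ?thesis .
    qed
    also have "\<dots> = N / (2 * r) * (2 * \<Delta>)"
      using X by (simp add: N_def \<Delta>_def H_def)
    also have "\<dots> \<le> real J * (2 * \<Delta>)" using J \<Delta> by (intro mult_right_mono) auto
    finally have "(X powr \<epsilon> / (16 * r)) ^ (2 * r) \<le> (real J * (2 * \<Delta>)) ^ (2 * r)"
      using r by (intro power_mono) auto
    moreover have "4 * X \<le> (X powr \<epsilon> / (16 * r)) ^ (2 * r)"
    proof -
      have "4 * X * (16 * r) ^ (2 * r) \<le> X * X"
        using mult_left_mono[OF X(6), of X] X by (simp add: mult_ac)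
      also have "\<dots> = X powr 2" using X by (simp add: power2_eq_square)
      also have "\<dots> \<le> X powr (\<epsilon> * (2 * r))" using X r by (intro powr_mono) (auto simp: mult_ac)
      also have "\<dots> = (X powr \<epsilon>) ^ (2 * r)"
        using X by (simp add: powr_powr flip: powr_realpow)
      finally show ?thesis using r by (simp add: power_divide field_simps)
    qed
    moreover have "2 * (real (r * J) + 1) \<le> 4 * X" using J N_le X by simp
    ultimately show ?thesis by linarith
  qed
  have "measure lebesgue B \<le> 12800 * (1 / real Z) powr (1 / 4) * X * D / card M"
  proof (rule measure_missed_by_products[OF Z(1) K_def _ _ _ _ _ _ _ _ _ size B_meas _ far])
    show "0 < X" "0 < 2 * \<Delta>" using X \<Delta> by auto
    show "finite M" unfolding M_def using fin by auto
    show "M \<noteq> {}" using card_M M_pos by auto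
    show "0 < D" using D N_ge by linarith
    have "real (r * J) < real (D + 1)" using J D by simp
    then show "r * J \<le> D" by linarith
    show "B \<subseteq> {X..2 * X}" by (auto simp: B_def exceptional_set_def)
    have "log_freq \<le> 16"
      using pi_less_4 ln2_ge_two_thirds by (simp add: log_freq_def field_simps)
    moreover have "real D \<le> real Z ^ 162" using D N_le by linarith
    ultimately have "log_freq * D \<le> real Z * real Z ^ 162"
      using Z by (intro mult_mono) auto
    also have "\<dots> \<le> real Z ^ 169"
      unfolding power_Suc[symmetric] using Z by (intro power_increasing) auto
    finally show "log_freq * D \<le> real Z ^ 169" .
  next
    fix m assume m: "m \<in> M"
    have "\<sigma> * N \<le> 7 / 5 * N" using \<sigma> N_ge by (intro mult_right_mono) auto
    then have "real m \<le> 7 / 5 * N" "N \<le> m" using M_bounds[OF m] by auto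
    then have "0 < real m" "real m \<le> 2 * real D" using D N_ge by linarith+
    then show "0 < m \<and> m \<le> 2 * D" by linarith
  next
    fix m m' assume m: "m \<in> M" "m' \<in> M"
    have "\<sigma> * N \<le> 7 / 5 * N" using \<sigma> N_ge by (intro mult_right_mono) auto
    then have "real m \<le> 7 / 5 * N" "N \<le> m'" using M_bounds[OF m(1)] M_bounds[OF m(2)] by auto
    then show "5 * m \<le> 7 * m'" by linarith
  qed
  also have "\<dots> \<le> 12800 * X powr (- 13 / 11000) * X * N / (s ^ 3 * N / (8 * C\<^sup>2 * X powr (1 / 2000)))"
  proof (intro frac_le mult_mono card_M M_pos)
    have "(1 / real Z) powr (1 / 4) = 1 / real Z powr (1 / 4)" by (simp add: powr_divide)
    also have "\<dots> \<le> 1 / (X powr (13 / 2750)) powr (1 / 4)"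
      using Z X by (intro divide_left_mono powr_mono2) auto
    also have "\<dots> = X powr (- 13 / 11000)" by (simp add: powr_powr powr_minus_divide)
    finally show "(1 / real Z) powr (1 / 4) \<le> X powr (- 13 / 11000)" .
  qed (use X D N_ge in auto)
  also have "\<dots> = 102400 * C\<^sup>2 / s ^ 3 * (X powr (1 / 2000) * X powr (- 13 / 11000)) * X"
    using N_ge s C X by (simp add: field_simps)
  \<comment> \<open>Divisor loss against exponential sum saving:
    \<open>1 / 2000 - 13 / 11000\<close> is negative, so this term is of lower order for fixed
    \<open>s\<close>.\<close>
  also have "X powr (1 / 2000) * X powr (- 13 / 11000) = X powr (1 / 2000 - 13 / 11000)"
    by (simp flip: powr_add)
  finally have main: "measure lebesgue B
      \<le> 102400 * C\<^sup>2 / s ^ 3 * X powr (1 / 2000 - 13 / 11000) * X" .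

  have X\<sigma>: "X \<le> \<sigma> * X" "2 * X / \<sigma> \<le> 2 * X"
    using X \<sigma> s by (auto simp: field_simps)
  have "measure lebesgue (exceptional_set \<epsilon> X)
      \<le> measure lebesgue (B \<union> ({X..\<sigma> * X} \<union> {2 * X / \<sigma>..2 * X}))"
  proof (rule measure_mono_fmeasurable)
    show "exceptional_set \<epsilon> X \<subseteq> B \<union> ({X..\<sigma> * X} \<union> {2 * X / \<sigma>..2 * X})"
      unfolding B_def by (auto simp: exceptional_set_def)
    show "exceptional_set \<epsilon> X \<in> sets lebesgue" using exceptional_set_borel by auto
    show "B \<union> ({X..\<sigma> * X} \<union> {2 * X / \<sigma>..2 * X}) \<in> lmeasurable"
      using B_meas by (intro fmeasurable.Un) auto
  qed
  also have "\<dots> \<le> measure lebesgue B + measure lebesgue ({X..\<sigma> * X} \<union> {2 * X / \<sigma>..2 * X})"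
    using B_meas by (intro measure_Un_le) (auto simp: fmeasurableD)
  also have "measure lebesgue ({X..\<sigma> * X} \<union> {2 * X / \<sigma>..2 * X})
      \<le> measure lebesgue {X..\<sigma> * X} + measure lebesgue {2 * X / \<sigma>..2 * X}"
    by (intro measure_Un_le) auto
  also have "measure lebesgue {X..\<sigma> * X} = (\<sigma> - 1) * X"
    using X\<sigma> by (simp add: algebra_simps)
  also have "measure lebesgue {2 * X / \<sigma>..2 * X} = 2 * X - 2 * X / \<sigma>"
    using X\<sigma> by simp
  also have "2 * X - 2 * X / \<sigma> \<le> 2 * ((\<sigma> - 1) * X)"
  proof -
    have "2 * X - 2 * X / \<sigma> = 2 * ((\<sigma> - 1) * X) / \<sigma>" using \<sigma> by (simp add: field_simps)
    also have "\<dots> \<le> 2 * ((\<sigma> - 1) * X) / 1" using \<sigma> s X by (intro divide_left_mono) auto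
    finally show ?thesis by simp
  qed
  \<comment> \<open>The strip at \<open>X\<close> has length at most \<open>4 * s * X\<close> and
    the one at \<open>2 * X\<close> at most twice that, which together give
    \<open>12 * s * X\<close>.\<close>
  also have "(\<sigma> - 1) * X \<le> 4 * s * X" using \<sigma> X by (intro mult_right_mono) auto
  finally show ?thesis using main by linarith
qed

section \<open>Reduction to small \<open>\<epsilon>\<close> and passage to the limit\<close>

lemma exceptional_set_antimono:
  assumes "\<epsilon> \<le> \<epsilon>'" "1 \<le> X"
  shows "exceptional_set \<epsilon>' X \<subseteq> exceptional_set \<epsilon> X"
proof -
  have "x powr (13 / 55 + \<epsilon>) \<le> x powr (13 / 55 + \<epsilon>')" if "X \<le> x" for x
    using assms that by (intro powr_mono) auto
  then show ?thesis unfolding exceptional_set_def by fastforce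
qed

theorem theorem3:
  fixes \<epsilon> :: real
  assumes "\<epsilon> > 0"
  shows "(\<lambda>X::real. measure lebesgue (exceptional_set \<epsilon> X)) \<in> o[at_top](\<lambda>X. X)"
proof (rule landau_o.smallI)
  fix c :: real assume c: "0 < c"
  \<comment> \<open>A smaller exponent only enlarges the exceptional set. With
    \<open>\<epsilon>' < 42 / 55\<close> the interval is short compared with \<open>X\<close>, so
    its relative length eventually falls below \<open>s\<close>.\<close>
  define \<epsilon>' where "\<epsilon>' = min \<epsilon> (1 / 10)"
  have \<epsilon>': "0 < \<epsilon>'" "\<epsilon>' \<le> \<epsilon>" "\<epsilon>' \<le> 1 / 10" using assms by (auto simp: \<epsilon>'_def)
  \<comment> \<open>\<open>12 * s \<le> c / 2\<close> pays for the trimmed strips. As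
    \<open>s\<close> depends only on \<open>c\<close>, the factor \<open>1 / s ^ 3\<close> in the
    other term is a constant when \<open>X\<close> grows.\<close>
  define s where "s = min (1 / 10) (c / 24)"
  have s: "0 < s" "s \<le> 1 / 10" "12 * s \<le> c / 2" using c by (auto simp: s_def)
  obtain r0 :: nat where "1 / \<epsilon>' \<le> r0" using real_arch_simple by blast
  moreover define r where "r = Suc r0"
  ultimately have r: "1 \<le> r" "1 \<le> r * \<epsilon>'"
    using \<epsilon>' by (auto simp: field_simps)
  obtain C where C: "0 < C" "\<And>n :: nat. 0 < n \<Longrightarrow> card {d. d dvd n} \<le> C * real n powr (1 / 4000)"
    using divisor_bound[of "1 / 4000"] by auto
  have large: "eventually (\<lambda>X :: real. b \<le> X powr a) at_top" if "0 < a" for a b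
    using real_powr_at_top[OF that] by (auto simp: filterlim_at_top)
  have small: "eventually (\<lambda>X :: real. X powr a < b) at_top" if "a < 0" "0 < b" for a b
    using tendsto_neg_powr[OF that(1) filterlim_ident] that(2) by (rule order_tendstoD)
  define \<eta> where "\<eta> = c / 2 / (102400 * C\<^sup>2 / s ^ 3)"
  have pos: "0 < 102400 * C\<^sup>2 / s ^ 3" using C s by simp
  then have \<eta>: "0 < \<eta>" unfolding \<eta>_def using c by (intro divide_pos_pos[of "c / 2"]) simp
  have "eventually (\<lambda>X :: real. max 1 (4 * (16 * r) ^ (2 * r)) \<le> X) at_top"
    by (rule eventually_ge_at_top)
  moreover have "eventually (\<lambda>X :: real. 1000 \<le> X powr (13 / 2750)) at_top" by (rule large) simp
  moreover have "eventually (\<lambda>X :: real. 4 / s \<le> X powr (16 / 165)) at_top" by (rule large) simp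
  moreover have "eventually (\<lambda>X :: real. 8 * r \<le> X powr (42 / 55)) at_top" by (rule large) simp
  moreover have "eventually (\<lambda>X :: real. X powr (\<epsilon>' - 42 / 55) < s) at_top"
    using \<epsilon>' s by (intro small) auto
  moreover have "eventually (\<lambda>X :: real. X powr (1 / 2000 - 13 / 11000) < \<eta>) at_top"
    using \<eta> by (intro small) auto
  ultimately show "eventually (\<lambda>X. norm (measure lebesgue (exceptional_set \<epsilon> X)) \<le> c * norm X) at_top"
  proof eventually_elim
    case (elim X)
    have X1: "1 \<le> X" using elim(1) by simp
    have "measure lebesgue (exceptional_set \<epsilon> X) \<le> measure lebesgue (exceptional_set \<epsilon>' X)"
    proof (rule measure_mono_fmeasurable)
      show "exceptional_set \<epsilon> X \<subseteq> exceptional_set \<epsilon>' X"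
        by (rule exceptional_set_antimono[OF \<epsilon>'(2) X1])
      show "exceptional_set \<epsilon> X \<in> sets lebesgue" using exceptional_set_borel by auto
      have "exceptional_set \<epsilon>' X \<in> sets lebesgue" using exceptional_set_borel by auto
      then show "exceptional_set \<epsilon>' X \<in> lmeasurable"
        by (rule fmeasurableI2[of "{X..2 * X}", rotated 2]) (auto simp: exceptional_set_def)
    qed
    also have "\<dots> \<le> 12 * s * X + 102400 * C\<^sup>2 / s ^ 3 * X powr (1 / 2000 - 13 / 11000) * X"
    proof (rule exceptional_set_measure_le[OF \<epsilon>'(1) s(1,2) _ _ C])
      show "4 \<le> s * X powr (16 / 165)" using elim(3) s by (simp add: field_simps)
    qed (use X1 elim r in auto)
    also have "\<dots> \<le> c / 2 * X + c / 2 * X"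
    proof (intro add_mono mult_right_mono)
      have "102400 * C\<^sup>2 / s ^ 3 * X powr (1 / 2000 - 13 / 11000) \<le> 102400 * C\<^sup>2 / s ^ 3 * \<eta>"
        using elim(6) pos by (intro mult_left_mono) auto
      also have "\<dots> = c / 2"
      proof -
        have "a * (b / a) = b" if "0 < a" for a b :: real using that by simp
        from this[OF pos] show ?thesis by (simp only: \<eta>_def)
      qed
      finally show "102400 * C\<^sup>2 / s ^ 3 * X powr (1 / 2000 - 13 / 11000) \<le> c / 2" .
    qed (use s X1 in auto)
    finally show ?case using X1 by (simp add: mult.commute)
  qed
qed

end
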